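(* Let $X$ be a locally connected compact metrizable group and $T$ a minimal rotation of $X$. Let $u\mapsto A_u$ be a continuous action of $\mathbb R$ on $\mathbb R^d$ by linear automorphisms such that for every $u\neq0$ the map $A_u$ has no eigenvalue equal to $1$, and let $G=\mathbb R^d\rtimes\mathbb R$ with multiplication $(v_1,u_1)\cdot(v_2,u_2)=(v_1+A_{u_1}(v_2),u_1+u_2)$. If $f:X\to G$ is continuous and its cocycle is recurrent, then $f$ is regular, i.e. some $T_f$-orbit closure in $X\times G$ projects onto $X$.
   Context: Cocycle: $f(n,x)=f(T^{n-1}x)\cdots f(x)$ ($n\ge1$), $f(0,x)=e$, $f(n,x)=f(-n,T^nx)^{-1}$ ($n<0$); $T_f^n(x,g)=(T^nx,f(n,x)g)$ on $X\times G$. Recurrent: for every open neighbourhood $V$ of $e$ and nonempty open $\mathcal U\subseteq X$ there is $n\ne0$ with $\mathcal U\cap T^{-n}\mathcal U\cap\{x:f(n,x)\in V\}\ne\varnothing$. A minimal rotation is $Tx=ax$ for a fixed $a\in X$ with all orbits dense. *)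

theory Defs
  imports "HOL-Analysis.Analysis"
begin

text \<open>Integer iterates of the rotation T x = a + x (group written additively, not
necessarily commutative).\<close>
definition rot_pow :: "'x::group_add \<Rightarrow> int \<Rightarrow> 'x \<Rightarrow> 'x" where
  "rot_pow a n x = (if 0 \<le> n then (((+) a) ^^ nat n) x else (((+) (- a)) ^^ nat (- n)) x)"

definition minimal_rotation :: "'x::{group_add,topological_space} \<Rightarrow> bool" where
  "minimal_rotation a \<longleftrightarrow> (\<forall>x. closure {rot_pow a n x | n. True} = UNIV)"

definition sd_mult :: "(real \<Rightarrow> real^'d \<Rightarrow> real^'d) \<Rightarrow> ((real^'d) \<times> real) \<Rightarrow> ((real^'d) \<times> real) \<Rightarrow> ((real^'d) \<times> real)" where
  "sd_mult A p q = (fst p + A (snd p) (fst q), snd p + snd q)"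

definition sd_unit :: "(real^'d) \<times> real" where
  "sd_unit = (0, 0)"

definition sd_inv :: "(real \<Rightarrow> real^'d \<Rightarrow> real^'d) \<Rightarrow> ((real^'d) \<times> real) \<Rightarrow> ((real^'d) \<times> real)" where
  "sd_inv A p = (- A (- snd p) (fst p), - snd p)"

fun cocycle_nat :: "(real \<Rightarrow> real^'d \<Rightarrow> real^'d) \<Rightarrow> 'x::group_add \<Rightarrow> ('x \<Rightarrow> (real^'d) \<times> real) \<Rightarrow> nat \<Rightarrow> 'x \<Rightarrow> (real^'d) \<times> real" where
  "cocycle_nat A a f 0 x = sd_unit"
| "cocycle_nat A a f (Suc n) x = sd_mult A (f (rot_pow a (int n) x)) (cocycle_nat A a f n x)"

definition cocycle :: "(real \<Rightarrow> real^'d \<Rightarrow> real^'d) \<Rightarrow> 'x::group_add \<Rightarrow> ('x \<Rightarrow> (real^'d) \<times> real) \<Rightarrow> int \<Rightarrow> 'x \<Rightarrow> (real^'d) \<times> real" where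
  "cocycle A a f n x = (if 0 \<le> n then cocycle_nat A a f (nat n) x
     else sd_inv A (cocycle_nat A a f (nat (- n)) (rot_pow a n x)))"

definition skew_pow :: "(real \<Rightarrow> real^'d \<Rightarrow> real^'d) \<Rightarrow> 'x::group_add \<Rightarrow> ('x \<Rightarrow> (real^'d) \<times> real) \<Rightarrow> int \<Rightarrow> 'x \<times> ((real^'d) \<times> real) \<Rightarrow> 'x \<times> ((real^'d) \<times> real)" where
  "skew_pow A a f n p = (rot_pow a n (fst p), sd_mult A (cocycle A a f n (fst p)) (snd p))"

definition recurrent_cocycle :: "(real \<Rightarrow> real^'d \<Rightarrow> real^'d) \<Rightarrow> 'x::{group_add,topological_space} \<Rightarrow> ('x \<Rightarrow> (real^'d) \<times> real) \<Rightarrow> bool" where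
  "recurrent_cocycle A a f \<longleftrightarrow>
     (\<forall>V U. open V \<and> sd_unit \<in> V \<and> open U \<and> U \<noteq> {} \<longrightarrow>
        (\<exists>n::int. n \<noteq> 0 \<and>
           U \<inter> {x. rot_pow a n x \<in> U} \<inter> {x. cocycle A a f n x \<in> V} \<noteq> {}))"

definition regular_cocycle :: "(real \<Rightarrow> real^'d \<Rightarrow> real^'d) \<Rightarrow> 'x::{group_add,topological_space} \<Rightarrow> ('x \<Rightarrow> (real^'d) \<times> real) \<Rightarrow> bool" where
  "regular_cocycle A a f \<longleftrightarrow>
     (\<exists>p. fst ` closure {skew_pow A a f n p | n. True} = UNIV)"

end

theory Submission
  imports Defs
begin

text \<open>The real part \<open>\<phi>\<close> of the cocycle is either a coboundary or has every real number as an
  essential value. In the first case the cocycle is conjugate to one in \<open>\<real>\<^sup>d\<close>, whose values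
  are bounded modulo the closed group of essential values. In the second case the vertical
  essential values form a subspace \<open>\<Lambda>\<close> invariant under the flow. As \<open>\<phi>\<close> is unbounded, the essential
  values at a generic point \<open>x\<close> are not locally contained in \<open>\<Lambda>\<close>; since the action has no fixed
  vectors, they then contain a conjugate of \<open>\<real>\<close> by some \<open>w\<close>, unique modulo \<open>\<Lambda>\<close>. By Baire
  category \<open>w\<close> can be bounded over an open set, so generic orbits return with bounded fibre
  coordinates.\<close>

section \<open>Preliminaries on closed sets, closed subgroups and rotations\<close>

text \<open>The obstacle is noncommutativity: essential values are only conjugated along an orbit,
  so \<open>ess x\<close> depends on \<open>x\<close>, and closure under products is derived only at
  the generic points called \<open>good\<close>. Boundedness is therefore measured modulo a normal
  closed subgroup contained in every \<open>ess y\<close>: all of \<open>ess x\<close> for abelian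
  values, \<open>{0}\<close> for a real cocycle with discrete essential values,
  \<open>vertical \<times> {0}\<close> in the transitive case. Absence of the eigenvalue 1 makes
  \<open>w - A u w\<close> bijective in \<open>w\<close> for \<open>u \<noteq> 0\<close>, so each
  \<open>(v, u)\<close> is the conjugate of \<open>(0, u)\<close> by \<open>(w, 0)\<close> for
  exactly one \<open>w\<close>. This \<open>w\<close> tracks the orbit: if
  \<open>F n x = (b, \<phi>)\<close>, the vector at \<open>x\<close> corresponds to
  \<open>b + A \<phi> w\<close> at \<open>T n x\<close>, so a bound on it over an open set bounds
  the fibre coordinate there. Local connectedness enters only in the boundedness argument. A
  periodic rotation is split off because that argument needs recurrence at arbitrarily large
  times.\<close>

lemma closed_proj_compact:
  fixes C :: "('a::metric_space \<times> 'b::metric_space) set"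
  assumes "compact S" "closed C"
  shows "closed {x. \<exists>s\<in>S. (x, s) \<in> C}"
  unfolding closed_sequential_limits
proof (intro allI impI, elim conjE)
  fix x l assume x: "\<forall>n. x n \<in> {x. \<exists>s\<in>S. (x, s) \<in> C}" and l: "x \<longlonglongrightarrow> l"
  then have "\<forall>n. \<exists>s. s \<in> S \<and> (x n, s) \<in> C"
    by auto
  then obtain s where s: "\<And>n. s n \<in> S" "\<And>n. (x n, s n) \<in> C"
    by (auto dest!: choice)
  obtain t r where t: "t \<in> S" "strict_mono r" "(s \<circ> r) \<longlonglongrightarrow> t"
    using seq_compactE[of S s] assms(1) s(1) by (auto simp: compact_eq_seq_compact_metric)
  have "(\<lambda>n. ((x \<circ> r) n, (s \<circ> r) n)) \<longlonglongrightarrow> (l, t)"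
    by (intro tendsto_Pair LIMSEQ_subseq_LIMSEQ[OF l] t)
  moreover have "\<forall>n. ((x \<circ> r) n, (s \<circ> r) n) \<in> C"
    using s by simp
  ultimately have "(l, t) \<in> C"
    using closed_sequentially[OF assms(2), of "\<lambda>n. ((x \<circ> r) n, (s \<circ> r) n)"] by simp
  then show "l \<in> {x. \<exists>s\<in>S. (x, s) \<in> C}"
    using t by blast
qed

lemma Baire_compact_cover:
  fixes \<G> :: "'a::metric_space set set"
  assumes "compact (UNIV :: 'a set)" "countable \<G>" "\<And>S. S \<in> \<G> \<Longrightarrow> closed S" "\<Union>\<G> = UNIV"
  shows "\<exists>S\<in>\<G>. interior S \<noteq> {}"
proof (rule ccontr)
  assume "\<not> ?thesis"
  then have "closedin euclidean S \<and> euclidean interior_of S = {}" if "S \<in> \<G>" for S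
    using assms(3) that by (auto simp: interior_of_def interior_def)
  moreover have "locally_compact_space (euclidean :: 'a topology)"
    by (simp add: assms(1) compact_imp_locally_compact_space compact_space_def)
  moreover have "regular_space (euclidean :: 'a topology)"
    by (simp add: metrizable_imp_regular_space metrizable_space_euclidean)
  ultimately have "euclidean interior_of \<Union>\<G> = {}"
    using assms(2) by (intro Baire_category_alt) auto
  then show False
    using assms(4) by (metis interior_of_topspace topspace_euclidean UNIV_not_empty)
qed

text \<open>Integer multiples of \<open>q k\<close> form a grid of vanishing mesh on a line whose
  direction tends to \<open>d\<close>, so they approximate every point of the limit line.\<close>

lemma closed_subgroup_contains_limit_line:
  fixes S :: "'a::euclidean_space set"
  assumes "closed S" and z: "0 \<in> S" and add: "\<And>x y. x \<in> S \<Longrightarrow> y \<in> S \<Longrightarrow> x + y \<in> S"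
    and neg: "\<And>x. x \<in> S \<Longrightarrow> - x \<in> S"
    and q: "\<And>k. q k \<in> S" "\<And>k. q k \<noteq> 0" "q \<longlonglongrightarrow> 0" "(\<lambda>k. q k /\<^sub>R norm (q k)) \<longlonglongrightarrow> d"
  shows "t *\<^sub>R d \<in> S"
proof -
  have nat_mult: "real n *\<^sub>R x \<in> S" if "x \<in> S" for x n
    using that by (induction n) (auto simp: algebra_simps z add)
  have int_mult: "of_int n *\<^sub>R x \<in> S" if "x \<in> S" for x n
    using nat_mult[OF that, of "nat n"] neg[OF nat_mult[OF that, of "nat (- n)"]]
    by (cases "0 \<le> n") auto
  \<comment> \<open>The largest integer multiple of \<open>norm (q k)\<close> not exceeding
    \<open>t\<close>; it misses \<open>t\<close> by at most the mesh.\<close>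
  define c where "c k = of_int \<lfloor>t / norm (q k)\<rfloor> * norm (q k)" for k
  have "\<bar>c k - t\<bar> \<le> norm (q k)" for k
  proof -
    have "\<bar>of_int \<lfloor>t / norm (q k)\<rfloor> - t / norm (q k)\<bar> \<le> 1"
      by linarith
    then have "\<bar>of_int \<lfloor>t / norm (q k)\<rfloor> - t / norm (q k)\<bar> * norm (q k) \<le> 1 * norm (q k)"
      by (intro mult_right_mono) auto
    also have "\<bar>of_int \<lfloor>t / norm (q k)\<rfloor> - t / norm (q k)\<bar> * norm (q k) = \<bar>c k - t\<bar>"
    proof -
      have "c k - t = (of_int \<lfloor>t / norm (q k)\<rfloor> - t / norm (q k)) * norm (q k)"
        using q(2)[of k] by (simp add: c_def left_diff_distrib)
      then show ?thesis
        by (simp add: abs_mult)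
    qed
    finally show ?thesis by simp
  qed
  then have "(\<lambda>k. c k - t) \<longlonglongrightarrow> 0"
    by (intro Lim_null_comparison[OF _ tendsto_norm_zero[OF q(3)]] always_eventually allI) simp
  then have "c \<longlonglongrightarrow> t"
    by (simp add: LIM_zero_iff)
  then have "(\<lambda>k. c k *\<^sub>R (q k /\<^sub>R norm (q k))) \<longlonglongrightarrow> t *\<^sub>R d"
    using q(4) by (intro tendsto_scaleR)
  moreover have "c k *\<^sub>R (q k /\<^sub>R norm (q k)) \<in> S" for k
    using int_mult[OF q(1), of "\<lfloor>t / norm (q k)\<rfloor>" k] q(2)[of k] by (simp add: c_def mult.assoc)
  ultimately show ?thesis
    using closed_sequentially[OF assms(1), of "\<lambda>k. c k *\<^sub>R (q k /\<^sub>R norm (q k))"] by blast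
qed

lemma closed_subgroup_real_UNIV:
  fixes S :: "real set"
  assumes "closed S" "0 \<in> S" "\<And>x y. x \<in> S \<Longrightarrow> y \<in> S \<Longrightarrow> x + y \<in> S" "\<And>x. x \<in> S \<Longrightarrow> - x \<in> S"
    and small: "\<And>e. e > 0 \<Longrightarrow> \<exists>x\<in>S. x \<noteq> 0 \<and> \<bar>x\<bar> \<le> e"
  shows "S = UNIV"
proof -
  have "\<exists>x\<in>S. x > 0 \<and> x \<le> inverse (real (Suc k))" for k
    using small[of "inverse (real (Suc k))"] assms(4) by (smt (verit) of_nat_0_less_iff positive_imp_inverse_positive zero_less_Suc)
  then obtain q where q: "\<And>k. q k \<in> S" "\<And>k. q k > 0" "\<And>k. q k \<le> inverse (real (Suc k))"
    by metis
  have lim: "q \<longlonglongrightarrow> 0"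
    using q by (intro Lim_null_comparison[OF _ LIMSEQ_inverse_real_of_nat] always_eventually allI)
      (simp add: less_imp_le)
  have "(\<lambda>k. q k /\<^sub>R norm (q k)) = (\<lambda>k. 1)"
    using q(2) by (simp add: fun_eq_iff less_imp_neq[symmetric] abs_of_pos)
  moreover have "q k \<noteq> 0" for k
    using q(2)[of k] by simp
  ultimately have "t *\<^sub>R 1 \<in> S" for t
    using q lim by (intro closed_subgroup_contains_limit_line[of S q]) (auto simp: assms)
  then show ?thesis by auto
qed

lemma rot_pow_Suc: "rot_pow a (n + 1) x = a + rot_pow a n x"
proof (cases "0 \<le> n")
  case True
  then show ?thesis
    by (simp add: rot_pow_def nat_add_distrib)
next
  case False
  then obtain k where k: "nat (- n) = Suc k" "n = - int (Suc k)"
    by (metis nat_0_iff neg_le_0_iff_le not0_implies_Suc int_nat_eq minus_minus linorder_not_le not_less_iff_gr_or_eq neg_0_le_iff_le)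
  have "rot_pow a (n + 1) x = (((+) (- a)) ^^ k) x"
    using k by (cases k) (auto simp: rot_pow_def nat_add_distrib)
  moreover have "rot_pow a n x = - a + (((+) (- a)) ^^ k) x"
    using k False by (simp add: rot_pow_def)
  ultimately show ?thesis
    by (metis add.assoc add.right_inverse add_0)
qed

lemma rot_pow_0 [simp]: "rot_pow a 0 x = x"
  by (simp add: rot_pow_def)

lemma rot_pow_pred: "rot_pow a (n - 1) x = - a + rot_pow a n x"
  using rot_pow_Suc[of a "n - 1" x] by (simp flip: add.assoc)

lemma rot_pow_add: "rot_pow a (m + n) x = rot_pow a m (rot_pow a n x)"
proof (induction m rule: int_induct[where k = 0])
  case (step1 i)
  then show ?case
    using rot_pow_Suc[of a "i + n" x] rot_pow_Suc[of a i] by (simp add: ac_simps)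
next
  case (step2 i)
  then show ?case
    using rot_pow_pred[of a "i + n" x] rot_pow_pred[of a i] by (simp add: algebra_simps)
qed auto

text \<open>Iterates are left translations, so the displacement \<open>T n 0\<close> controls
  \<open>T n\<close> at all points simultaneously.\<close>

lemma rot_pow_translate: "rot_pow a n x = rot_pow a n 0 + x"
proof (induction n rule: int_induct[where k = 0])
  case (step1 i)
  then show ?case
    by (simp add: rot_pow_Suc add.assoc)
next
  case (step2 i)
  then show ?case
    by (simp add: rot_pow_pred add.assoc)
qed auto

lemma rot_pow_uminus: "rot_pow a (- n) 0 = - rot_pow a n 0"
proof -
  have "rot_pow a (- n) 0 + rot_pow a n 0 = 0"
    by (metis add.left_inverse rot_pow_0 rot_pow_add rot_pow_translate)
  then show ?thesis
    by (simp add: eq_neg_iff_add_eq_0)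
qed

lemma rot_pow_diff: "rot_pow a (m - n) 0 = rot_pow a m 0 - rot_pow a n 0"
  using rot_pow_add[of a m "- n" 0] rot_pow_translate[of a m "rot_pow a (- n) 0"]
  by (simp add: rot_pow_uminus)

lemma continuous_on_rot_pow [continuous_intros]:
  fixes a :: "'x::topological_group_add"
  assumes "continuous_on S h"
  shows "continuous_on S (\<lambda>z. rot_pow a n (h z))"
  by (subst rot_pow_translate) (intro continuous_intros assms)

section \<open>Essential values and orbit closures of cocycles\<close>

text \<open>The unit is the zero vector, so norm balls about 0 are neighbourhoods of the unit. The
  locale serves addition on the reals and on \<open>real^'d\<close> as well as the semidirect
  product.\<close>

locale topological_group_on =
  fixes mul :: "'g::euclidean_space \<Rightarrow> 'g \<Rightarrow> 'g" (infixl \<open>\<odot>\<close> 70) and iv :: "'g \<Rightarrow> 'g"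
  assumes mul_assoc: "x \<odot> y \<odot> z = x \<odot> (y \<odot> z)"
    and mul_0_left [simp]: "0 \<odot> x = x"
    and mul_0_right [simp]: "x \<odot> 0 = x"
    and iv_left [simp]: "iv x \<odot> x = 0"
    and iv_right [simp]: "x \<odot> iv x = 0"
    and continuous_mul: "continuous_on UNIV (\<lambda>p. fst p \<odot> snd p)"
    and continuous_iv: "continuous_on UNIV iv"
begin

lemma cancel_left [simp]: "iv x \<odot> (x \<odot> y) = y" "x \<odot> (iv x \<odot> y) = y"
  by (simp_all flip: mul_assoc)

lemma cancel_right [simp]: "x \<odot> y \<odot> iv y = x" "x \<odot> iv y \<odot> y = x"
  by (simp_all add: mul_assoc)

lemma iv_unique: "x \<odot> y = 0 \<Longrightarrow> iv x = y"
  by (metis cancel_left(1) mul_0_right)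

lemma iv_mul: "iv (x \<odot> y) = iv y \<odot> iv x"
  by (rule iv_unique) (simp add: mul_assoc)

lemma iv_0 [simp]: "iv 0 = 0"
  by (rule iv_unique) simp

lemma iv_iv [simp]: "iv (iv x) = x"
  by (rule iv_unique) simp

lemma continuous_on_mul [continuous_intros]:
  assumes "continuous_on S f" "continuous_on S g"
  shows "continuous_on S (\<lambda>x. f x \<odot> g x)"
  using continuous_on_compose2[OF continuous_mul continuous_on_Pair[OF assms]] by simp

lemma continuous_on_iv [continuous_intros]:
  assumes "continuous_on S f"
  shows "continuous_on S (\<lambda>x. iv (f x))"
  using continuous_on_compose2[OF continuous_iv assms] by simp

end

locale minimal_rot =
  fixes a :: "'x::{topological_group_add, metric_space}"
  assumes compact_space: "compact (UNIV :: 'x set)"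
    and locally_connected: "locally_connected_space (euclidean :: 'x topology)"
    and minimal: "minimal_rotation a"
    and free: "n \<noteq> 0 \<Longrightarrow> rot_pow a n 0 \<noteq> 0"
begin

abbreviation T :: "int \<Rightarrow> 'x \<Rightarrow> 'x" where "T \<equiv> rot_pow a"

lemma orbit_dense: "closure (range (\<lambda>n. T n x)) = UNIV"
  using minimal by (simp add: minimal_rotation_def full_SetCompr_eq)

lemma orbit_meets_open:
  assumes "open U" "U \<noteq> {}"
  shows "\<exists>n. T n x \<in> U"
proof -
  have "U \<inter> range (\<lambda>n. T n x) \<noteq> {}"
    using open_Int_closure_eq_empty[OF assms(1), of "range (\<lambda>n. T n x)"] assms(2)
    by (simp add: orbit_dense)
  then show ?thesis by blast
qed

text \<open>Compactness makes the time needed to enter \<open>U\<close> uniformly bounded.\<close>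

lemma finite_translates_cover:
  assumes "open U" "U \<noteq> {}"
  obtains J where "finite J" "\<And>y. \<exists>j\<in>J. T j y \<in> U"
proof -
  have op: "open {y. T j y \<in> U}" for j
    using assms(1) continuous_on_rot_pow[OF continuous_on_id, of UNIV a j]
    by (simp add: continuous_on_open_vimage vimage_def)
  have cov: "UNIV \<subseteq> (\<Union>j\<in>UNIV. {y. T j y \<in> U})"
    using orbit_meets_open[OF assms] by auto
  obtain J where J: "finite J" "UNIV \<subseteq> (\<Union>j\<in>J. {y. T j y \<in> U})"
    by (rule compactE_image[OF compact_space op cov])
  have "\<exists>j\<in>J. T j y \<in> U" for y
    using subsetD[OF J(2) UNIV_I, of y] by simp
  with J(1) show ?thesis
    by (rule that)
qed

lemma T_inverse [simp]: "T (- n) (T n x) = x" "T n (T (- n) x) = x"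
  by (simp_all flip: rot_pow_add)

end

locale rot_cocycle = minimal_rot a + topological_group_on mul iv
  for a :: "'x::{topological_group_add, metric_space}"
    and mul :: "'g::euclidean_space \<Rightarrow> 'g \<Rightarrow> 'g" (infixl \<open>\<odot>\<close> 70) and iv :: "'g \<Rightarrow> 'g" +
  fixes F :: "int \<Rightarrow> 'x \<Rightarrow> 'g"
  assumes cocycle: "F (m + n) x = F m (T n x) \<odot> F n x"
    and continuous_F: "continuous_on UNIV (F n)"
    and recurrent: "open V \<Longrightarrow> 0 \<in> V \<Longrightarrow> open U \<Longrightarrow> U \<noteq> {} \<Longrightarrow>
        \<exists>n y. n \<noteq> 0 \<and> y \<in> U \<and> T n y \<in> U \<and> F n y \<in> V"
begin

lemma continuous_on_F [continuous_intros]: "continuous_on S h \<Longrightarrow> continuous_on S (\<lambda>x. F n (h x))"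
  using continuous_on_compose2[OF continuous_F] by blast

lemma F_0 [simp]: "F 0 x = 0"
  using cocycle[of 0 0 x] by (metis add.left_neutral cancel_right(1) iv_right rot_pow_0)

lemma F_uminus: "F (- n) (T n x) = iv (F n x)"
  using cocycle[of "- n" n x] iv_unique by (metis F_0 ab_left_minus iv_iv)

definition graph :: "('x \<times> 'x \<times> 'g) set" where
  "graph = range (\<lambda>(n, y). (y, T n y, F n y))"

text \<open>Limits of \<open>F n y\<close> with both \<open>y\<close> and \<open>T n y\<close>
  tending to \<open>x\<close>. Letting the base point \<open>y\<close> vary makes membership a
  closed condition in \<open>x\<close> and \<open>g\<close> jointly.\<close>

definition ess :: "'x \<Rightarrow> 'g set" where
  "ess x = {g. (x, x, g) \<in> closure graph}"

text \<open>The closure of the skew product orbit of \<open>(x, 0)\<close>.\<close>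

definition orb :: "'x \<Rightarrow> ('x \<times> 'g) set" where
  "orb x = closure (range (\<lambda>n. (T n x, F n x)))"

text \<open>Here essential values are already seen along the orbit of \<open>x\<close> itself; with
  \<open>orb_imp_ess\<close>, \<open>ess x\<close> is then exactly the fibre of \<open>orb x\<close>
  over \<open>x\<close>.\<close>

definition good :: "'x \<Rightarrow> bool" where
  "good x \<longleftrightarrow> (\<forall>g\<in>ess x. (x, g) \<in> orb x)"

lemma graph_mem: "(y, T n y, F n y) \<in> closure graph"
  unfolding graph_def by (intro subsetD[OF closure_subset]) auto

lemma orb_mem: "(T n x, F n x) \<in> orb x"
  unfolding orb_def by (intro subsetD[OF closure_subset]) auto

lemma closed_orb: "closed (orb x)"
  by (simp add: orb_def)

lemma graph_map:
  assumes "p \<in> closure graph" "continuous_on UNIV h" "\<And>n y. h (y, T n y, F n y) \<in> closure graph"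
  shows "h p \<in> closure graph"
proof -
  have "h ` closure graph \<subseteq> closure graph"
    using assms(2,3) by (intro image_closure_subset) (auto simp: graph_def intro: continuous_on_subset)
  then show ?thesis using assms(1) by blast
qed

lemma orb_map:
  assumes "p \<in> orb x" "continuous_on UNIV h" "closed C" "\<And>n. h (T n x, F n x) \<in> C"
  shows "h p \<in> C"
proof -
  have "h ` closure (range (\<lambda>n. (T n x, F n x))) \<subseteq> C"
    using assms(2-4) by (intro image_closure_subset) (auto intro: continuous_on_subset)
  then show ?thesis using assms(1) by (auto simp: orb_def)
qed

lemma ess_closed_graph: "closed {p. h (snd p) \<in> ess (fst p)}" if "continuous_on UNIV h"
proof -
  have "continuous_on UNIV (\<lambda>p. (fst p, fst p, h (snd p)))"
    by (intro continuous_intros continuous_on_compose2[OF that]) auto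
  then have "closed ((\<lambda>p. (fst p, fst p, h (snd p))) -` closure graph)"
    by (intro closed_vimage) auto
  then show ?thesis
    by (simp add: ess_def vimage_def)
qed

lemma closed_ess: "closed (ess x)"
proof -
  have "closed ((\<lambda>g. (x, x, g)) -` closure graph)"
    by (intro closed_vimage) (auto intro!: continuous_intros)
  then show ?thesis
    by (simp add: ess_def vimage_def)
qed

lemma ess_0: "0 \<in> ess x"
  using graph_mem[of x 0] by (simp add: ess_def)

lemma ess_iv: "g \<in> ess x \<Longrightarrow> iv g \<in> ess x"
proof -
  assume g: "g \<in> ess x"
  have "(\<lambda>(y, y', g). (y', y, iv g)) (x, x, g) \<in> closure graph"
  proof (rule graph_map[where h = "\<lambda>(y, y', g). (y', y, iv g)"])
    show "continuous_on UNIV (\<lambda>(y, y', g). (y', y, iv g))"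
      unfolding split_beta by (intro continuous_intros)
    show "(case (y, T n y, F n y) of (y, y', g) \<Rightarrow> (y', y, iv g)) \<in> closure graph" for n y
      using graph_mem[of "T n y" "- n"] by (simp add: F_uminus)
  qed (use g in \<open>simp add: ess_def\<close>)
  then show ?thesis by (simp add: ess_def)
qed

text \<open>Computing \<open>F (n + j) y\<close> in two ways gives \<open>F n (T j y)\<close> as
  \<open>F n y\<close> multiplied by \<open>F j (T n y)\<close> on the left and
  \<open>iv (F j y)\<close> on the right; both outer factors converge, since \<open>y\<close> and
  \<open>T n y\<close> tend to \<open>x\<close>.\<close>

lemma ess_conj:
  assumes "g \<in> ess x"
  shows "F j x \<odot> g \<odot> iv (F j x) \<in> ess (T j x)"
proof -
  have "(\<lambda>(y, y', g). (T j y, T j y', F j y' \<odot> g \<odot> iv (F j y))) (x, x, g) \<in> closure graph"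
  proof (rule graph_map[where h = "\<lambda>(y, y', g). (T j y, T j y', F j y' \<odot> g \<odot> iv (F j y))"])
    show "continuous_on UNIV (\<lambda>(y, y', g). (T j y, T j y', F j y' \<odot> g \<odot> iv (F j y)))"
      unfolding split_beta by (intro continuous_intros)
    show "(case (y, T n y, F n y) of (y, y', g) \<Rightarrow> (T j y, T j y', F j y' \<odot> g \<odot> iv (F j y))) \<in> closure graph" for n y
      using graph_mem[of "T j y" n] cocycle[of j n y] cocycle[of n j y]
      by (simp add: add.commute flip: rot_pow_add)
  qed (use assms in \<open>simp add: ess_def\<close>)
  then show ?thesis by (simp add: ess_def)
qed

lemma ess_cont_limit:
  assumes "(y, h) \<in> closure (range (\<lambda>n. (T n x, c n)))" "continuous_on UNIV k" "\<And>n. k (c n) \<in> ess (T n x)"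
  shows "k h \<in> ess y"
proof -
  have "closure (range (\<lambda>n. (T n x, c n))) \<subseteq> {p. k (snd p) \<in> ess (fst p)}"
    using assms(3) by (intro closure_minimal ess_closed_graph assms) auto
  then show ?thesis using assms(1) by auto
qed

lemma graph_append:
  assumes "l \<in> ess y"
  shows "(y, T n y, F n y \<odot> l) \<in> closure graph"
proof -
  have "(\<lambda>(y, y', g). (y, T n y', F n y' \<odot> g)) (y, y, l) \<in> closure graph"
  proof (rule graph_map[where h = "\<lambda>(y, y', g). (y, T n y', F n y' \<odot> g)"])
    show "continuous_on UNIV (\<lambda>(y, y', g). (y, T n y', F n y' \<odot> g))"
      unfolding split_beta by (intro continuous_intros)
    show "(case (y, T m y, F m y) of (y, y', g) \<Rightarrow> (y, T n y', F n y' \<odot> g)) \<in> closure graph" for m y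
      using graph_mem[of y "n + m"] by (simp add: cocycle rot_pow_add)
  qed (use assms in \<open>simp add: ess_def\<close>)
  then show ?thesis by simp
qed

lemma orb_invariant:
  assumes "(y, h) \<in> orb x"
  shows "(T j y, F j y \<odot> h) \<in> orb x"
proof -
  have "(\<lambda>(y, h). (T j y, F j y \<odot> h)) (y, h) \<in> orb x"
  proof (rule orb_map[OF assms _ closed_orb, where h = "\<lambda>(y, h). (T j y, F j y \<odot> h)"])
    show "continuous_on UNIV (\<lambda>(y, h). (T j y, F j y \<odot> h))"
      unfolding split_beta by (intro continuous_intros)
    show "(case (T n x, F n x) of (y, h) \<Rightarrow> (T j y, F j y \<odot> h)) \<in> orb x" for n
      using orb_mem[of "j + n" x] by (simp add: cocycle rot_pow_add)
  qed
  then show ?thesis by simp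
qed

text \<open>Right multiplication by \<open>g\<close> commutes with the skew product, hence carries
  the orbit of \<open>(x, 0)\<close> to that of \<open>(x, g)\<close>, which stays in
  \<open>orb x\<close>.\<close>

lemma orb_append:
  assumes "(y, h) \<in> orb x" "(x, g) \<in> orb x"
  shows "(y, h \<odot> g) \<in> orb x"
proof -
  have "(\<lambda>(y, h). (y, h \<odot> g)) (y, h) \<in> orb x"
  proof (rule orb_map[OF assms(1) _ closed_orb, where h = "\<lambda>(y, h). (y, h \<odot> g)"])
    show "continuous_on UNIV (\<lambda>(y, h). (y, h \<odot> g))"
      unfolding split_beta by (intro continuous_intros)
  qed (use orb_invariant[OF assms(2)] in simp)
  then show ?thesis by simp
qed

lemma orb_imp_ess:
  assumes "(x, g) \<in> orb x"
  shows "g \<in> ess x"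
proof -
  have "(\<lambda>(y, h). (x, y, h)) (x, g) \<in> closure graph"
    by (rule orb_map[OF assms, where h = "\<lambda>(y, h). (x, y, h)"]) (auto simp: split_beta graph_mem intro!: continuous_intros)
  then show ?thesis by (simp add: ess_def)
qed

lemma good_ess_mul:
  assumes "good x" "g \<in> ess x" "h \<in> ess x"
  shows "g \<odot> h \<in> ess x"
  using orb_imp_ess[OF orb_append, of x g h] assms by (simp add: good_def)

text \<open>The projection of the part of \<open>orb x\<close> over the compact \<open>K\<close> is
  closed and contains a dense orbit.\<close>

lemma orb_surj_if_bounded:
  assumes "compact K" "\<And>n. \<exists>k\<in>K. (T n x, k) \<in> orb x"
  shows "fst ` orb x = UNIV"
proof -
  have "closed {y. \<exists>k\<in>K. (y, k) \<in> orb x}"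
    by (intro closed_proj_compact assms closed_orb)
  moreover have "range (\<lambda>n. T n x) \<subseteq> {y. \<exists>k\<in>K. (y, k) \<in> orb x}"
    using assms(2) by auto
  ultimately have "{y. \<exists>k\<in>K. (y, k) \<in> orb x} = UNIV"
    using closure_minimal[of "range (\<lambda>n. T n x)"] orbit_dense[of x] by (simp add: top.extremum_unique)
  then have surj: "\<exists>k\<in>K. (y, k) \<in> orb x" for y
    by (simp add: set_eq_iff)
  have "y \<in> fst ` orb x" for y
    using surj[of y] by (auto intro: rev_image_eqI)
  then show ?thesis by auto
qed

text \<open>Frontiers of open sets are nowhere dense. Off countably many of them, a visit made by
  points arbitrarily near \<open>x\<close> is also made by \<open>x\<close>.\<close>

lemma bad_points_meagre:
  obtains \<G> where "countable \<G>" "\<And>S. S \<in> \<G> \<Longrightarrow> closed S \<and> interior S = {}" "\<And>x. x \<notin> \<Union>\<G> \<Longrightarrow> good x"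
proof -
  obtain \<B> :: "'g set set" where B: "countable \<B>" "topological_basis \<B>"
    using ex_countable_basis by blast
  \<comment> \<open>Balls of radius \<open>1/(m+1)\<close> about the points of a dense orbit act as
    a countable base of the rotation space, so countably many sets \<open>D k m V\<close>
    suffice.\<close>
  define D where "D k m V = {y. \<exists>n. T n y \<in> ball (T k 0) (inverse (real (Suc m))) \<and> F n y \<in> V}"
    for k :: int and m :: nat and V
  have openD: "open (D k m V)" if "V \<in> \<B>" for k m V
  proof -
    have "open V" using B that topological_basis_open by blast
    then have "open (\<Union>n. T n -` ball (T k 0) (inverse (real (Suc m))) \<inter> F n -` V)"
      by (intro open_UN ballI open_Int open_vimage continuous_F)
        (auto intro: continuous_on_rot_pow[OF continuous_on_id])
    also have "\<dots> = D k m V" by (auto simp: D_def)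
    finally show ?thesis .
  qed
  define \<G> where "\<G> = (\<lambda>(k, m, V). frontier (D k m V)) ` (UNIV \<times> UNIV \<times> \<B>)"
  have "good x" if x: "x \<notin> \<Union>\<G>" for x
    unfolding good_def
  proof
    fix g assume g: "g \<in> ess x"
    show "(x, g) \<in> orb x"
      unfolding orb_def closure_iff_nhds_not_empty
    proof (intro allI impI)
      fix A W assume "W \<subseteq> A" "open W" "(x, g) \<in> W"
      then obtain U V' where UV': "open U" "open V'" "x \<in> U" "g \<in> V'" "U \<times> V' \<subseteq> W"
        by (metis mem_Sigma_iff open_prod_elim)
      obtain V where V: "V \<in> \<B>" "g \<in> V" "V \<subseteq> V'"
        using topological_basisE[OF B(2) UV'(2,4)] by blast
      have "open V" using B V topological_basis_open by blast
      obtain e where e: "e > 0" "ball x e \<subseteq> U"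
        using UV' open_contains_ball by blast
      obtain m where m: "inverse (real (Suc m)) < e / 2"
        using reals_Archimedean[of "e / 2"] e by auto
      define d where "d = inverse (real (Suc m))"
      have "d > 0" by (simp add: d_def)
      obtain k where k: "T k 0 \<in> ball x d"
        using orbit_meets_open[of "ball x d" 0] \<open>d > 0\<close> by auto
      have xk: "x \<in> ball (T k 0) d" using k by (simp add: dist_commute)
      have sub: "ball (T k 0) d \<subseteq> U"
      proof
        fix z assume "z \<in> ball (T k 0) d"
        then have "dist x z < e"
          using k m dist_triangle[of x z "T k 0"] by (auto simp: d_def)
        then show "z \<in> U" using e by auto
      qed
      \<comment> \<open>That \<open>g\<close> is essential provides points of \<open>D k m V\<close>
        near \<open>x\<close>; since \<open>x\<close> avoids the frontier, it lies in
        \<open>D k m V\<close> itself.\<close>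
      have "x \<in> closure (D k m V)"
        unfolding closure_iff_nhds_not_empty
      proof (intro allI impI)
        fix A W assume W: "W \<subseteq> A" "open W" "x \<in> W"
        have "open ((W \<inter> ball (T k 0) d) \<times> ball (T k 0) d \<times> V)"
          using W \<open>open V\<close> by (intro open_Times open_Int) auto
        moreover have "(x, x, g) \<in> (W \<inter> ball (T k 0) d) \<times> ball (T k 0) d \<times> V"
          using W xk V by auto
        ultimately have "(W \<inter> ball (T k 0) d) \<times> ball (T k 0) d \<times> V \<inter> graph \<noteq> {}"
          using g unfolding ess_def by (metis open_Int_closure_eq_empty disjoint_iff mem_Collect_eq)
        then show "D k m V \<inter> A \<noteq> {}"
          using W by (fastforce simp: graph_def D_def d_def)
      qed
      moreover have "x \<notin> frontier (D k m V)"
        using x V(1) by (auto simp: \<G>_def)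
      ultimately have "x \<in> D k m V"
        using interior_subset by (auto simp: frontier_def)
      then obtain n where "T n x \<in> ball (T k 0) d" "F n x \<in> V"
        by (auto simp: D_def d_def)
      then have "(T n x, F n x) \<in> W"
        using sub V(3) by (intro subsetD[OF UV'(5)]) blast
      then show "range (\<lambda>n. (T n x, F n x)) \<inter> A \<noteq> {}"
        using \<open>W \<subseteq> A\<close> by blast
    qed
  qed
  moreover have "countable \<G>"
    using B by (auto simp: \<G>_def)
  moreover have "closed S \<and> interior S = {}" if "S \<in> \<G>" for S
  proof -
    obtain k m V where S: "S = frontier (D k m V)" "V \<in> \<B>"
      using \<open>S \<in> \<G>\<close> by (auto simp: \<G>_def)
    have "interior S \<inter> D k m V = {}"
      using interior_subset[of S] openD[OF S(2)] S(1) by (auto simp: frontier_def interior_open)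
    then have "interior S \<inter> closure (D k m V) = {}"
      by (simp add: open_Int_closure_eq_empty)
    then show ?thesis
      using interior_subset[of S] S(1) by (auto simp: frontier_def)
  qed
  ultimately show ?thesis
    using that by blast
qed

end

section \<open>Boundedness modulo essential values\<close>

lemma continuous_nhds_prodE:
  fixes h :: "'a::topological_space \<Rightarrow> 'b::topological_space \<Rightarrow> 'c::topological_space"
  assumes "continuous_on UNIV (\<lambda>p. h (fst p) (snd p))" "open W" "h x y \<in> W"
  obtains A B where "open A" "open B" "x \<in> A" "y \<in> B" "\<forall>u\<in>A. \<forall>v\<in>B. h u v \<in> W"
proof -
  have "open ((\<lambda>p. h (fst p) (snd p)) -` W)"
    using assms by (intro open_vimage)
  moreover have "(x, y) \<in> (\<lambda>p. h (fst p) (snd p)) -` W"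
    using assms by simp
  ultimately obtain A B where AB: "open A" "open B" "(x, y) \<in> A \<times> B" "A \<times> B \<subseteq> (\<lambda>p. h (fst p) (snd p)) -` W"
    by (rule open_prod_elim)
  then have "\<forall>u\<in>A. \<forall>v\<in>B. h u v \<in> W"
    by auto
  with AB show thesis
    using that[of A B] by simp
qed

context rot_cocycle
begin

text \<open>On a connected neighbourhood \<open>U0\<close> of \<open>x0\<close> the values \<open>F n\<close>, for \<open>T n\<close> close to the
  identity, are either all small modulo \<open>L\<close> or all outside a ball, as otherwise a value on the
  boundary would be essential. So the times with small values behave like a neighbourhood of the
  identity in a locally compact monothetic group, which by recurrence is not discrete; as in Weil's
  lemma they form a syndetic set.\<close>

lemma bounded_mod_subgroup:
  assumes cl: "closed L" and L0: "0 \<in> L" and Lmul: "\<And>g h. g \<in> L \<Longrightarrow> h \<in> L \<Longrightarrow> g \<odot> h \<in> L"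
    and Liv: "\<And>g. g \<in> L \<Longrightarrow> iv g \<in> L" and normal: "\<And>g l. l \<in> L \<Longrightarrow> g \<odot> l \<odot> iv g \<in> L"
    and Less: "\<And>y. L \<subseteq> ess y"
    and "e0 > 0" and small: "\<And>g. g \<in> ess x0 \<Longrightarrow> norm g \<le> e0 \<Longrightarrow> g \<in> L"
  obtains K where "compact K" "\<And>n. \<exists>k\<in>K. \<exists>l\<in>L. F n x0 = k \<odot> l"
proof -
  \<comment> \<open>The product set of \<open>C\<close> and \<open>L\<close>, that is, the preimage
    of the image of \<open>C\<close> in the quotient by \<open>L\<close>.\<close>
  define sat where "sat C = {g. \<exists>l\<in>L. g \<odot> iv l \<in> C}" for C
  have satI: "k \<odot> l \<in> sat C" if "k \<in> C" "l \<in> L" for k l C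
    using that by (auto simp: sat_def intro!: bexI[of _ l])
  have sat_self: "k \<in> sat C" if "k \<in> C" for k C
    using satI[OF that L0] by simp
  have satE: "\<exists>k\<in>C. \<exists>l\<in>L. g = k \<odot> l" if g: "g \<in> sat C" for g C
  proof -
    obtain l where "l \<in> L" "g \<odot> iv l \<in> C" using g by (auto simp: sat_def)
    then show ?thesis by (intro bexI[of _ "g \<odot> iv l"] bexI[of _ l]) auto
  qed
  have open_sat: "open (sat C)" if "open C" for C
  proof -
    have "open (\<Union>l\<in>L. (\<lambda>g. g \<odot> iv l) -` C)"
      by (intro open_UN ballI open_vimage that) (intro continuous_intros)
    also have "\<dots> = sat C" by (auto simp: sat_def)
    finally show ?thesis .
  qed
  have closed_sat: "closed (sat C)" if "compact C" for C
  proof -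
    have "closed ((\<lambda>p. iv (snd p) \<odot> fst p) -` L)"
      by (intro closed_vimage cl) (intro continuous_intros)
    then have "closed {g. \<exists>k\<in>C. (g, k) \<in> (\<lambda>p. iv (snd p) \<odot> fst p) -` L}"
      by (intro closed_proj_compact that)
    also have "{g. \<exists>k\<in>C. (g, k) \<in> (\<lambda>p. iv (snd p) \<odot> fst p) -` L} = sat C" (is "?A = _")
    proof (intro set_eqI iffI)
      fix g assume "g \<in> ?A"
      then obtain k where "k \<in> C" "iv k \<odot> g \<in> L" by auto
      from satI[OF this] show "g \<in> sat C" by simp
    next
      fix g assume "g \<in> sat C"
      then obtain k l where "k \<in> C" "l \<in> L" "g = k \<odot> l" using satE by blast
      then show "g \<in> ?A" by (auto intro!: bexI[of _ k])
    qed
    finally show ?thesis .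
  qed

  have "continuous_on UNIV (\<lambda>p. fst p \<odot> iv (snd p))"
    by (intro continuous_intros)
  moreover have "0 \<odot> iv 0 \<in> ball 0 e0"
    using \<open>e0 > 0\<close> by simp
  ultimately obtain A B where AB: "open A" "open B" "0 \<in> A" "0 \<in> B"
      "\<forall>g\<in>A. \<forall>h\<in>B. g \<odot> iv h \<in> ball 0 e0"
    by (rule continuous_nhds_prodE[where h = "\<lambda>g h. g \<odot> iv h", OF _ open_ball])
  then obtain d where d: "d > 0" "ball 0 d \<subseteq> A \<inter> B"
    using open_contains_ball_eq[of "A \<inter> B"] by (meson IntI open_Int)
  \<comment> \<open>At most \<open>d\<close> so that quotients of elements of the
    \<open>e1\<close>-ball have norm at most \<open>e0\<close>; at most \<open>e0\<close> so that
    \<open>B1\<close> lies in \<open>B0\<close>.\<close>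
  define e1 where "e1 = min d e0"
  have e1: "e1 > 0" "e1 \<le> e0" "ball 0 e1 \<subseteq> ball 0 d"
    using d \<open>e0 > 0\<close> by (auto simp: e1_def)
  have diff_small: "norm (g \<odot> iv h) \<le> e0" if "g \<in> ball 0 e1" "h \<in> ball 0 e1" for g h
  proof -
    have "g \<odot> iv h \<in> ball 0 e0" using that e1(3) d(2) AB(5) by blast
    then show ?thesis by simp
  qed
  define B1 where "B1 = sat (ball 0 e1)"
  define B0 where "B0 = sat (cball 0 e0)"
  have B1: "open B1" and B0: "closed B0"
    by (auto simp: B1_def B0_def open_sat closed_sat)
  have ball_B1: "ball 0 e1 \<subseteq> B1" using sat_self by (auto simp: B1_def)
  have B1_B0: "B1 \<subseteq> B0" 
  proof
    fix g assume "g \<in> B1"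
    then obtain l where "l \<in> L" "norm (g \<odot> iv l) < e1" by (auto simp: B1_def sat_def)
    then show "g \<in> B0" using e1(2) by (auto simp: B0_def sat_def intro!: bexI[of _ l])
  qed
  \<comment> \<open>Normality lets the \<open>L\<close>-parts be moved to the right past
    \<open>iv k'\<close>.\<close>
  have diff_B: "g \<odot> iv h \<in> B0" if gh: "g \<in> B1" "h \<in> B1" for g h
  proof -
    obtain k l where k: "k \<in> ball 0 e1" "l \<in> L" "g = k \<odot> l" using satE[of g "ball 0 e1"] gh(1) unfolding B1_def by blast
    obtain k' l' where k': "k' \<in> ball 0 e1" "l' \<in> L" "h = k' \<odot> l'" using satE[of h "ball 0 e1"] gh(2) unfolding B1_def by blast
    have "g \<odot> iv h = k \<odot> iv k' \<odot> (k' \<odot> (l \<odot> iv l') \<odot> iv k')"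
      by (simp add: k k' iv_mul mul_assoc)
    moreover have "k' \<odot> (l \<odot> iv l') \<odot> iv k' \<in> L"
      using k k' by (intro normal Lmul Liv)
    moreover have "k \<odot> iv k' \<in> cball 0 e0"
      using diff_small[OF k(1) k'(1)] by simp
    ultimately show ?thesis by (simp only: B0_def satI)
  qed

  \<comment> \<open>A compact shell containing no essential value of \<open>x0\<close>, because the
    small ones lie in \<open>L\<close> and so in \<open>B1\<close>. Compactness extends the
    avoidance to pairs of points near \<open>(x0, x0)\<close>.\<close>
  define S where "S = cball 0 e0 - B1"
  have "compact S"
    unfolding S_def by (intro compact_diff B1 compact_cball)
  define P where "P = {q. \<exists>s\<in>S. (q, s) \<in> (\<lambda>p. (fst (fst p), snd (fst p), snd p)) -` closure graph}"
  have "closed ((\<lambda>p. (fst (fst p), snd (fst p), snd p)) -` closure graph)"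
    by (intro closed_vimage) (auto intro!: continuous_intros)
  then have "closed P"
    unfolding P_def by (intro closed_proj_compact \<open>compact S\<close>)
  have cont_pair: "continuous_on UNIV (\<lambda>p::'x \<times> 'x. (fst p, snd p))"
    by (intro continuous_intros)
  from \<open>closed P\<close> have "open (- P)"
    by (rule open_Compl)
  moreover have "(x0, x0) \<in> - P"
  proof
    assume "(x0, x0) \<in> P"
    then obtain s where s: "s \<in> S" "s \<in> ess x0" by (auto simp: P_def ess_def)
    then have "s \<in> L" using small by (simp add: S_def)
    then have "s \<in> B1" using satI[of 0 "ball 0 e1" s] e1 by (simp add: B1_def)
    then show False using s by (simp add: S_def)
  qed
  ultimately obtain U2 U3 where U23: "open U2" "open U3" "x0 \<in> U2" "x0 \<in> U3"
      "\<forall>y\<in>U2. \<forall>z\<in>U3. (y, z) \<in> - P"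
    by (rule continuous_nhds_prodE[of Pair "- P" x0 x0, OF cont_pair])
  define U where "U = U2 \<inter> U3"
  have U: "open U" "x0 \<in> U" using U23 by (auto simp: U_def)
  \<comment> \<open>A value in \<open>B0\<close> but not in \<open>B1\<close> could be stripped of
    its \<open>L\<close>-part by \<open>graph_append\<close>, as \<open>L\<close> lies in every
    \<open>ess y\<close>, leaving a limit value in the shell.\<close>
  have jump: "F n y \<in> B1 \<or> F n y \<notin> B0" if y: "y \<in> U" "T n y \<in> U" for n y
  proof (rule ccontr)
    assume neg: "\<not> ?thesis"
    then obtain k l where k: "k \<in> cball 0 e0" "l \<in> L" "F n y = k \<odot> l"
      using satE[of "F n y" "cball 0 e0"] unfolding B0_def by blast
    have "k \<notin> B1"
    proof
      assume "k \<in> B1"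
      then obtain k' l' where "k' \<in> ball 0 e1" "l' \<in> L" "k = k' \<odot> l'"
        using satE[of k "ball 0 e1"] unfolding B1_def by blast
      then have "F n y \<in> B1"
        using k satI[of k' "ball 0 e1" "l' \<odot> l"] Lmul by (simp add: B1_def mul_assoc)
      then show False using neg by simp
    qed
    moreover have "(y, T n y, k) \<in> closure graph"
      using graph_append[of "iv l" y n] Less[of y] Liv[OF k(2)] k(3) by auto
    ultimately have "(y, T n y) \<in> P"
      using k(1) by (auto simp: P_def S_def intro!: bexI[of _ k])
    then show False using y U23(5) by (auto simp: U_def)
  qed

  have "continuous_on UNIV (\<lambda>p::'x \<times> 'x. fst p + snd p)"
    by (intro continuous_intros)
  moreover have "0 + x0 \<in> U"
    using U by simp
  ultimately obtain N1 U1 where NU: "open N1" "open U1" "0 \<in> N1" "x0 \<in> U1"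
      "\<forall>z\<in>N1. \<forall>y\<in>U1. z + y \<in> U"
    by (rule continuous_nhds_prodE[where h = "(+)", OF _ U(1)])
  obtain U0 where U0: "open U0" "connected U0" "x0 \<in> U0" "U0 \<subseteq> U1 \<inter> U"
    using locally_connected[unfolded locally_connected_space, rule_format, of "U1 \<inter> U" x0] NU U
    by (auto simp: open_openin[symmetric])
  define N where "N = N1 \<inter> (\<lambda>z. z + x0) -` U0"
  have "open N"
    unfolding N_def by (intro open_Int open_vimage NU U0) (intro continuous_intros)
  have "0 \<in> N" using NU U0 by (simp add: N_def)
  \<comment> \<open>By \<open>jump\<close>, the preimages of \<open>B1\<close> and of the complement
    of \<open>B0\<close> are disjoint open sets covering the connected \<open>U0\<close>, so one of
    them misses it.\<close>
  have dichotomy: "F n w \<in> B1" if n: "T n 0 \<in> N" and y: "y \<in> U0" "F n y \<in> B0" and w: "w \<in> U0" for n y w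
  proof (rule ccontr)
    assume "F n w \<notin> B1"
    have *: "F n z \<in> B1 \<or> F n z \<notin> B0" if "z \<in> U0" for z
    proof (rule jump)
      show "z \<in> U" using that U0 by auto
      have "T n 0 + z \<in> U" using that U0 n NU(5) unfolding N_def by blast
      then show "T n z \<in> U" by (metis rot_pow_translate)
    qed
    have "open (F n -` B1)" "open (F n -` (- B0))"
      using B1 B0 by (intro open_vimage continuous_F; simp add: open_Compl)+
    moreover have "U0 \<subseteq> F n -` B1 \<union> F n -` (- B0)" using * by auto
    moreover have "F n -` B1 \<inter> F n -` (- B0) \<inter> U0 = {}" using B1_B0 by auto
    moreover have "F n -` B1 \<inter> U0 \<noteq> {}" using *[OF y(1)] y by auto
    moreover have "F n -` (- B0) \<inter> U0 \<noteq> {}" using *[OF w] w \<open>F n w \<notin> B1\<close> by auto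
    ultimately show False using connectedD[OF U0(2), of "F n -` B1" "F n -` (- B0)"] by blast
  qed

  define Q where "Q = {n. T n 0 \<in> N \<and> F n x0 \<in> B1}"
  have Q0: "0 \<in> Q" using \<open>0 \<in> N\<close> ball_B1 e1 by (auto simp: Q_def)
  \<comment> \<open>The quotient of the two values is the value of \<open>F (n - m)\<close> at
    \<open>T m x0\<close>, known to lie only in \<open>B0\<close>; \<open>dichotomy\<close> both
    moves it to \<open>x0\<close> and sharpens it to \<open>B1\<close>.\<close>
  have Q_diff: "n - m \<in> Q" if "n \<in> Q" "m \<in> Q" "T (n - m) 0 \<in> N" for n m
  proof -
    have "F (n - m) (T m x0) = F n x0 \<odot> iv (F m x0)"
      using cocycle[of "n - m" m x0] by simp
    then have "F (n - m) (T m x0) \<in> B0"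
      using diff_B that by (simp add: Q_def)
    moreover have "T m x0 \<in> U0"
      using that(2) by (subst rot_pow_translate) (simp add: Q_def N_def)
    ultimately show ?thesis
      using dichotomy[OF that(3)] U0(3) that(3) by (simp add: Q_def)
  qed

  have cont_diff: "continuous_on UNIV (\<lambda>p::'x \<times> 'x. fst p - snd p)"
    by (intro continuous_intros)
  have "(0::'x) - 0 \<in> N"
    using \<open>0 \<in> N\<close> by simp
  then obtain N2 N3 where N23: "open N2" "open N3" "0 \<in> N2" "0 \<in> N3"
      "\<forall>z\<in>N2. \<forall>w\<in>N3. z - w \<in> N"
    by (rule continuous_nhds_prodE[where h = "(-)", OF cont_diff \<open>open N\<close>])
  define N' where "N' = N2 \<inter> N3 \<inter> uminus -` (N2 \<inter> N3)"
  have "open (uminus -` (N2 \<inter> N3))"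
    by (rule open_vimage[OF open_Int[OF N23(1,2)]]) (intro continuous_intros)
  then have N': "open N'" "0 \<in> N'"
    using N23 by (simp_all add: N'_def open_Int)
  have N'_diff: "z - w \<in> N" if "z \<in> N'" "w \<in> N'" for z w
    using that N23(5) by (auto simp: N'_def)
  have N'_N: "z \<in> N" if "z \<in> N'" for z
    using N'_diff[OF that N'(2)] by simp
  have N'_uminus: "- z \<in> N'" if "z \<in> N'" for z
    using that by (auto simp: N'_def)

  have net_compact: "compact (closure ((\<lambda>n. T n 0) ` Q))"
    using compact_Int_closed[OF compact_space closed_closure, of "(\<lambda>n. T n 0) ` Q"] by simp
  have net_open: "open {y. y - T m 0 \<in> N'}" for m
  proof -
    have "open ((\<lambda>y. y - T m 0) -` N')"
      by (rule open_vimage[OF N'(1)]) (intro continuous_intros)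
    then show ?thesis by (simp add: vimage_def)
  qed
  have net_cover: "closure ((\<lambda>n. T n 0) ` Q) \<subseteq> (\<Union>m\<in>Q. {y. y - T m 0 \<in> N'})"
  proof
    fix y assume y: "y \<in> closure ((\<lambda>n. T n 0) ` Q)"
    have "open ((\<lambda>w. y - w) -` N')"
      by (rule open_vimage[OF N'(1)]) (intro continuous_intros)
    then have "(\<lambda>w. y - w) -` N' \<inter> (\<lambda>n. T n 0) ` Q \<noteq> {}"
      using open_Int_closure_eq_empty[of "(\<lambda>w. y - w) -` N'" "(\<lambda>n. T n 0) ` Q"] y N'(2)
      unfolding disjoint_iff by (metis diff_self vimageI)
    then show "y \<in> (\<Union>m\<in>Q. {y. y - T m 0 \<in> N'})" by auto
  qed
  obtain M where M: "M \<subseteq> Q" "finite M"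
      "closure ((\<lambda>n. T n 0) ` Q) \<subseteq> (\<Union>m\<in>M. {y. y - T m 0 \<in> N'})"
    by (rule compactE_image[where f = "\<lambda>m. {y. y - T m 0 \<in> N'}", OF net_compact net_open net_cover])
  \<comment> \<open>A correction from the finite net \<open>M\<close> brings any time in
    \<open>Q\<close> to one with displacement in \<open>N'\<close>, leaving room for one more
    subtraction inside \<open>N\<close>.\<close>
  have net: "\<exists>m\<in>M. n - m \<in> Q \<and> T (n - m) 0 \<in> N'" if "n \<in> Q" for n
  proof -
    have "T n 0 \<in> closure ((\<lambda>n. T n 0) ` Q)"
      using that by (intro subsetD[OF closure_subset]) auto
    then obtain m where m: "m \<in> M" "T n 0 - T m 0 \<in> N'" using M(3) by auto
    then have "T (n - m) 0 \<in> N'" by (simp add: rot_pow_diff)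
    then show ?thesis using m M(1) Q_diff that N'_N by blast
  qed
  define b where "b = Max (insert 0 (abs ` M))"
  have b: "\<bar>m\<bar> \<le> b" if "m \<in> M" for m
    unfolding b_def using that M(2) by (intro Max_ge) auto

  \<comment> \<open>Displacements of the nonzero times of size at most \<open>b\<close>. Freeness
    keeps 0 out of \<open>Z\<close>, so recurrence near \<open>x0\<close> can be forced to occur at
    a time larger than \<open>b\<close>.\<close>
  define Z where "Z = (\<lambda>i. T i 0) ` ({-b..b} - {0})"
  have "finite Z" by (simp add: Z_def)
  have "0 \<notin> Z" using free by (force simp: Z_def)
  have "open (N' - Z)"
    by (intro open_Diff finite_imp_closed N' \<open>finite Z\<close>)
  moreover have "x0 - x0 \<in> N' - Z"
    using \<open>0 \<notin> Z\<close> N'(2) by simp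
  ultimately obtain U4 U5 where U45: "open U4" "open U5" "x0 \<in> U4" "x0 \<in> U5"
      "\<forall>z\<in>U4. \<forall>y\<in>U5. z - y \<in> N' - Z"
    by (rule continuous_nhds_prodE[where h = "(-)", OF cont_diff])
  obtain k0 y where k0: "k0 \<noteq> 0" "y \<in> U4 \<inter> U5 \<inter> U0" "T k0 y \<in> U4 \<inter> U5 \<inter> U0" "F k0 y \<in> ball 0 e1"
    using recurrent[of "ball 0 e1" "U4 \<inter> U5 \<inter> U0"] U45 U0 e1 by auto
  have "T k0 y - y \<in> N' - Z"
    using k0 U45(5) by auto
  moreover have "T k0 y - y = T k0 0"
    by (subst rot_pow_translate) simp
  ultimately have k0N: "T k0 0 \<in> N'" "T k0 0 \<notin> Z" by auto
  have "F k0 y \<in> B0"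
    using k0(4) ball_B1 B1_B0 by blast
  then have "k0 \<in> Q"
    using dichotomy[of k0 y x0] N'_N[OF k0N(1)] k0(2) U0(3) by (simp add: Q_def)
  have "T (0 - k0) 0 \<in> N'"
    using N'_uminus[OF k0N(1)] by (simp add: rot_pow_uminus)
  moreover from this have "0 - k0 \<in> Q"
    using Q_diff[OF Q0 \<open>k0 \<in> Q\<close>] N'_N by blast
  moreover have "\<bar>k0\<bar> > b"
  proof (rule ccontr)
    assume "\<not> \<bar>k0\<bar> > b"
    then have "k0 \<in> {-b..b} - {0}" using k0(1) by auto
    then show False using k0N(2) unfolding Z_def by blast
  qed
  moreover define k where "k = \<bar>k0\<bar>"
  ultimately have k: "k > b" "k \<in> Q" "- k \<in> Q" "T k 0 \<in> N'" "T (- k) 0 \<in> N'"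
    using \<open>k0 \<in> Q\<close> k0N by (auto simp: k_def abs_if)
  \<comment> \<open>Used with \<open>s = k\<close> and \<open>s = - k\<close>: as corrections
    satisfy \<open>\<bar>m\<bar> \<le> b < k\<close>, the result moves strictly down or up, and by
    less than \<open>2 * k\<close>.\<close>
  have step: "\<exists>m\<in>M. n - m - s \<in> Q" if "n \<in> Q" "s \<in> Q" "T s 0 \<in> N'" for n s
  proof -
    obtain m where m: "m \<in> M" "n - m \<in> Q" "T (n - m) 0 \<in> N'" using net \<open>n \<in> Q\<close> by blast
    then have "T (n - m - s) 0 \<in> N" using N'_diff that(3) by (simp add: rot_pow_diff)
    then show ?thesis using m Q_diff that by blast
  qed
  have down: "\<exists>n'\<in>Q. n' < n" if "n \<in> Q" for n
  proof -
    obtain m where "m \<in> M" "n - m - k \<in> Q" using step[OF \<open>n \<in> Q\<close> k(2,4)] by blast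
    then show ?thesis using b[of m] k(1) by (intro bexI[of _ "n - m - k"]) auto
  qed
  have up: "\<exists>n'\<in>Q. n < n' \<and> n' \<le> n + 2 * k" if "n \<in> Q" for n
  proof -
    obtain m where "m \<in> M" "n - m - (- k) \<in> Q" using step[OF \<open>n \<in> Q\<close> k(3,5)] by blast
    then show ?thesis using b[of m] k(1) by (intro bexI[of _ "n - m - (- k)"]) auto
  qed
  have low: "\<exists>n\<in>Q. n \<le> - int t" for t
  proof (induction t)
    case 0 then show ?case using Q0 by auto
  next
    case (Suc t)
    then obtain n where "n \<in> Q" "n \<le> - int t" by blast
    then obtain n' where "n' \<in> Q" "n' < n" using down by blast
    then show ?case using \<open>n \<le> - int t\<close> by (intro bexI[of _ n']) auto
  qed
  \<comment> \<open>Take the largest element of \<open>Q\<close> not above \<open>j\<close>, which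
    exists by \<open>low\<close>; its successor from \<open>up\<close> must exceed
    \<open>j\<close>.\<close>
  have syndetic: "\<exists>n\<in>Q. n \<le> j \<and> j \<le> n + 2 * k" for j
  proof -
    obtain n0 where "n0 \<in> Q" "n0 \<le> - int (nat (- j))"
      using low by blast
    then have "\<exists>n. n \<in> Q \<and> n \<le> j"
      by (intro exI[of _ n0]) linarith
    then obtain n where n: "n \<in> Q \<and> n \<le> j" "\<And>n'. n' \<in> Q \<and> n' \<le> j \<Longrightarrow> nat (j - n) \<le> nat (j - n')"
      using ex_has_least_nat[of "\<lambda>n. n \<in> Q \<and> n \<le> j" _ "\<lambda>n. nat (j - n)"] by blast
    obtain n' where n': "n' \<in> Q" "n < n'" "n' \<le> n + 2 * k" using up n by blast
    have "j \<le> n + 2 * k"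
      using n(2)[of n'] n' n(1) by (cases "n' \<le> j") auto
    then show ?thesis using n by blast
  qed

  \<comment> \<open>From the last time of \<open>Q\<close> at most \<open>2 * k\<close> further
    steps are made, each contributing a compact set of factors.\<close>
  define K where "K = (\<Union>i\<in>{0..2 * k}. (\<lambda>p. F i (fst p) \<odot> snd p) ` (UNIV \<times> cball 0 e1))"
  show thesis
  proof (rule that)
    show "compact K"
      unfolding K_def
      by (intro compact_UN compact_continuous_image compact_Times compact_space compact_cball)
        (auto intro!: continuous_intros)
    fix j
    obtain n where n: "n \<in> Q" "n \<le> j" "j \<le> n + 2 * k" using syndetic by blast
    obtain h l where h: "h \<in> ball 0 e1" "l \<in> L" "F n x0 = h \<odot> l"
      using n(1) satE[of "F n x0" "ball 0 e1"] unfolding Q_def B1_def by blast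
    have "F j x0 = F (j - n) (T n x0) \<odot> h \<odot> l"
      using cocycle[of "j - n" n x0] h by (simp add: mul_assoc)
    moreover have "F (j - n) (T n x0) \<odot> h \<in> K"
      unfolding K_def using n h
      by (intro UN_I[of "j - n"] image_eqI[of _ _ "(T n x0, h)"]) auto
    ultimately show "\<exists>k\<in>K. \<exists>l\<in>L. F j x0 = k \<odot> l"
      using h by blast
  qed
qed

end

section \<open>Abelian and real cocycles\<close>

context rot_cocycle
begin

lemma ex_good: "\<exists>x. good x"
proof (rule ccontr)
  assume none: "\<nexists>x. good x"
  obtain \<G> where G: "countable \<G>" "\<And>S. S \<in> \<G> \<Longrightarrow> closed S \<and> interior S = {}" "\<And>x. x \<notin> \<Union>\<G> \<Longrightarrow> good x"
    by (rule bad_points_meagre) blast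
  have "\<Union>\<G> = UNIV" using G(3) none by auto
  then show False using Baire_compact_cover[OF compact_space G(1)] G(2) by auto
qed

lemma dense_orbit_closed:
  assumes "closed S" "\<And>n. T n x \<in> S"
  shows "y \<in> S"
  using closure_minimal[of "range (\<lambda>n. T n x)" S] assms orbit_dense[of x] by auto

text \<open>Conjugation is trivial, so an essential value persists along the orbit of
  \<open>x\<close>, and then everywhere by closedness and density.\<close>

lemma ess_subset_if_commute:
  assumes "\<And>g h. g \<odot> h = h \<odot> g"
  shows "ess x \<subseteq> ess y"
proof
  fix g assume g: "g \<in> ess x"
  have "closed ((\<lambda>y. (y, y, g)) -` closure graph)"
    by (rule closed_vimage[OF closed_closure]) (intro continuous_intros)
  then have "closed {y. g \<in> ess y}"
    by (simp add: ess_def vimage_def)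
  moreover have "T n x \<in> {y. g \<in> ess y}" for n
    using ess_conj[OF g, of n] assms[of "F n x" g] by simp
  ultimately have "y \<in> {y. g \<in> ess y}"
    by (rule dense_orbit_closed)
  then show "g \<in> ess y" by simp
qed

text \<open>With \<open>L = ess x\<close> the smallness condition of
  \<open>bounded_mod_subgroup\<close> is automatic. At a good point the \<open>L\<close>-factor can
  be cancelled inside the orbit closure.\<close>

lemma abelian_orb_surj:
  assumes comm: "\<And>g h. g \<odot> h = h \<odot> g"
  shows "\<exists>x. fst ` orb x = UNIV"
proof -
  obtain x where x: "good x" using ex_good by blast
  have normal: "g \<odot> l \<odot> iv g \<in> ess x" if "l \<in> ess x" for g l
    using that comm[of g l] by simp
  obtain K where K: "compact K" "\<And>n. \<exists>k\<in>K. \<exists>l\<in>ess x. F n x = k \<odot> l"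
    by (rule bounded_mod_subgroup[of "ess x" 1 x])
      (use closed_ess ess_0 good_ess_mul[OF x] ess_iv normal ess_subset_if_commute[OF comm] in auto)
  have "\<exists>k\<in>K. (T n x, k) \<in> orb x" for n
  proof -
    obtain k l where kl: "k \<in> K" "l \<in> ess x" "F n x = k \<odot> l" using K(2) by blast
    have "(x, iv l) \<in> orb x"
      using x ess_iv[OF kl(2)] by (simp add: good_def)
    from orb_append[OF orb_mem[of n] this] have "(T n x, k) \<in> orb x"
      by (simp add: kl(3))
    then show ?thesis using kl(1) by blast
  qed
  then show ?thesis using orb_surj_if_bounded[OF K(1)] by blast
qed

end

text \<open>A closed subgroup of the reals with arbitrarily small nonzero elements is everything.
  Otherwise the cocycle is bounded along an orbit, and that orbit closure turns out to be the graph
  of a transfer function.\<close>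

lemma (in minimal_rot) real_cocycle_dichotomy:
  fixes F :: "int \<Rightarrow> 'x \<Rightarrow> real"
  assumes "rot_cocycle a (+) uminus F"
  shows "(\<forall>x. rot_cocycle.ess a F x = UNIV) \<or>
    (\<exists>\<psi>. continuous_on UNIV \<psi> \<and> (\<forall>n x. F n x = \<psi> (T n x) - \<psi> x))"
proof -
  interpret rot_cocycle a "(+)" uminus F by fact
  have comm: "g + h = h + g" for g h :: real by simp
  obtain x0 where x0: "good x0" using ex_good by blast
  have ess_mult: "real k * g \<in> ess x0" if "g \<in> ess x0" for k g
    by (induction k) (auto simp: ess_0 distrib_right intro!: good_ess_mul[OF x0] that)
  show ?thesis
  proof (cases "\<forall>e>0. \<exists>g\<in>ess x0. g \<noteq> 0 \<and> \<bar>g\<bar> \<le> e")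
    case True
    then have "ess x0 = UNIV"
      using closed_ess ess_0 good_ess_mul[OF x0] ess_iv by (intro closed_subgroup_real_UNIV) auto
    then show ?thesis using ess_subset_if_commute[OF comm, of x0] by blast
  next
    case False
    then obtain e where e: "e > 0" "\<And>g. g \<in> ess x0 \<Longrightarrow> \<bar>g\<bar> \<le> e \<Longrightarrow> g = 0" by blast
    \<comment> \<open>Discreteness of \<open>ess x0\<close> is enough to take the trivial subgroup
      as \<open>L\<close>, before \<open>ess x0\<close> itself is known to be trivial.\<close>
    obtain K where K: "compact K" "\<And>n. \<exists>k\<in>K. \<exists>l\<in>{0}. F n x0 = k + l"
      by (rule bounded_mod_subgroup[of "{0}" e x0]) (use e ess_0 in auto)
    have FK: "F n x0 \<in> K" for n using K(2)[of n] by auto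
    obtain C where C: "\<And>k. k \<in> K \<Longrightarrow> \<bar>k\<bar> \<le> C"
      using compact_imp_bounded[OF K(1)] by (auto simp: bounded_iff)
    have orbK: "s \<in> K" if "(y, s) \<in> orb x0" for y s
      using orb_map[OF that continuous_on_snd[OF continuous_on_id] compact_imp_closed[OF K(1)]] FK
      by simp
    \<comment> \<open>All multiples of an essential value occur in the fibre of
      \<open>orb x0\<close>, which is bounded.\<close>
    have ess0: "g = 0" if "g \<in> ess x0" for g
    proof (rule ccontr)
      assume "g \<noteq> 0"
      then obtain k where k: "real k * \<bar>g\<bar> > C" using ex_less_of_nat_mult[of "\<bar>g\<bar>" C] by auto
      have "(x0, real k * g) \<in> orb x0" using x0 ess_mult[OF that] by (simp add: good_def)
      then have "\<bar>real k * g\<bar> \<le> C" using orbK C by blast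
      then show False using k by (simp add: abs_mult)
    qed
    \<comment> \<open>Two values over the same \<open>y\<close> differ by an essential value, since
      the difference of two nearby orbit values is again a cocycle value.\<close>
    have unique: "s = t" if s: "(y, s) \<in> orb x0" and t: "(y, t) \<in> orb x0" for y s t
    proof -
      have *: "(T n x0, y, t - F n x0) \<in> closure graph" for n
      proof -
        have "(\<lambda>p. (T n x0, fst p, snd p - F n x0)) (y, t) \<in> closure graph"
        proof (rule orb_map[OF t, where h = "\<lambda>p. (T n x0, fst p, snd p - F n x0)"])
          show "continuous_on UNIV (\<lambda>p. (T n x0, fst p, snd p - F n x0))"
            by (intro continuous_intros)
          show "(T n x0, fst (T m x0, F m x0), snd (T m x0, F m x0) - F n x0) \<in> closure graph" for m
            using graph_mem[of "T n x0" "m - n"] cocycle[of "m - n" n x0] rot_pow_add[of a "m - n" n x0]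
            by simp
        qed simp
        then show ?thesis by simp
      qed
      have "(\<lambda>p. (fst p, y, t - snd p)) (y, s) \<in> closure graph"
      proof (rule orb_map[OF s, where h = "\<lambda>p. (fst p, y, t - snd p)"])
        show "continuous_on UNIV (\<lambda>p. (fst p, y, t - snd p))"
          by (intro continuous_intros)
      qed (use * in auto)
      then have "t - s \<in> ess x0"
        using ess_subset_if_commute[OF comm, of y x0] by (auto simp: ess_def)
      then show ?thesis using ess0[of "t - s"] by simp
    qed
    have "fst ` orb x0 = UNIV"
      by (rule orb_surj_if_bounded[OF K(1)]) (use orb_mem FK in blast)
    then have ex: "\<exists>s. (y, s) \<in> orb x0" for y
      using rangeI by (metis UNIV_I imageE prod.collapse)
    define \<psi> where "\<psi> y = (THE s. (y, s) \<in> orb x0)" for y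
    have \<psi>_eq: "\<psi> y = s" if "(y, s) \<in> orb x0" for y s
      unfolding \<psi>_def by (rule the_equality) (use that unique in blast)+
    have \<psi>: "(y, \<psi> y) \<in> orb x0" for y
      using ex[of y] \<psi>_eq by auto
    have "closed (\<psi> -` B)" if "closed B" for B
    proof -
      have "closed {y. \<exists>s\<in>K \<inter> B. (y, s) \<in> orb x0}"
        by (rule closed_proj_compact[OF compact_Int_closed[OF K(1) that] closed_orb])
      also have "{y. \<exists>s\<in>K \<inter> B. (y, s) \<in> orb x0} = \<psi> -` B"
        using \<psi> \<psi>_eq orbK by fastforce
      finally show ?thesis .
    qed
    then have "continuous_on UNIV \<psi>"
      by (simp add: continuous_on_closed_vimage)
    moreover have "F n x = \<psi> (T n x) - \<psi> x" for n x
      using \<psi>_eq[OF orb_invariant[OF \<psi>], of n x] by simp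
    ultimately show ?thesis by blast
  qed
qed

section \<open>Linear flows without fixed vectors\<close>

text \<open>By dimension, an injective linear map sending \<open>V\<close> into itself maps it onto
  \<open>V\<close>.\<close>

lemma subspace_injective_preimage:
  fixes g :: "'a::euclidean_space \<Rightarrow> 'a"
  assumes g: "linear g" "inj g" and V: "subspace V" "\<And>v. v \<in> V \<Longrightarrow> g v \<in> V" and z: "g z \<in> V"
  shows "z \<in> V"
proof -
  have "dim (g ` V) = dim V"
    using g by (intro dim_image_eq) (auto intro: inj_on_subset)
  then have "g ` V = V"
    using V g by (intro subspace_dim_equal linear_subspace_image) auto
  then have "g z \<in> g ` V" using z by simp
  then obtain v where "v \<in> V" "g z = g v" by (rule imageE)
  then show ?thesis using g(2) by (auto dest: injD)
qed

locale linear_flow =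
  fixes A :: "real \<Rightarrow> real^'d \<Rightarrow> real^'d"
  assumes linear_A: "linear (A u)"
    and A_0 [simp]: "A 0 v = v"
    and A_add: "A (u + w) v = A u (A w v)"
    and continuous_A: "continuous_on UNIV (\<lambda>(u, v). A u v)"
begin

lemma A_arith [simp]: "A u (v + w) = A u v + A u w" "A u (v - w) = A u v - A u w" "A u (- v) = - A u v"
    "A u 0 = 0" "A u (c *\<^sub>R v) = c *\<^sub>R A u v"
  using linear_A[of u] by (simp_all add: linear_add linear_diff linear_neg linear_0 linear_scale)

lemma A_inverse [simp]: "A u (A (- u) v) = v" "A (- u) (A u v) = v"
  by (simp_all flip: A_add)

lemma continuous_on_A [continuous_intros]:
  assumes "continuous_on S f" "continuous_on S g"
  shows "continuous_on S (\<lambda>x. A (f x) (g x))"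
  using continuous_on_compose2[OF continuous_A continuous_on_Pair[OF assms]] by simp

lemma sd_group: "topological_group_on (sd_mult A) (sd_inv A)"
proof
  show "continuous_on UNIV (\<lambda>p. sd_mult A (fst p) (snd p))"
    unfolding sd_mult_def by (intro continuous_intros)
  show "continuous_on UNIV (sd_inv A)"
    unfolding sd_inv_def by (intro continuous_intros)
qed (auto simp: sd_mult_def sd_inv_def A_add prod_eq_iff algebra_simps)

end

locale expansive_flow = linear_flow A for A :: "real \<Rightarrow> real^'d \<Rightarrow> real^'d" +
  assumes no_fixed: "u \<noteq> 0 \<Longrightarrow> A u v = v \<Longrightarrow> v = 0"
begin

lemma linear_diff_A: "linear (\<lambda>w. w - A u w)"
  by (intro linear_compose_sub linear_A linear_id[unfolded id_def])

lemma inj_diff_A: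
  assumes "u \<noteq> 0"
  shows "inj (\<lambda>w. w - A u w)"
  using no_fixed[OF assms] by (simp add: linear_injective_0[OF linear_diff_A])

lemma surj_diff_A:
  assumes "u \<noteq> 0"
  obtains w where "w - A u w = v"
  using surjD[OF linear_injective_imp_surjective[OF linear_diff_A inj_diff_A[OF assms]], of v] that
  by auto

text \<open>An invariant closed subgroup is a linear subspace: an element \<open>q\<close> outside the largest subspace
  \<open>V\<close> it contains gives small nonzero elements \<open>A u q - q\<close> modulo \<open>V\<close>, and hence a further line.\<close>

lemma invariant_subgroup_diff_A:
  assumes "closed L" and z: "0 \<in> L" and add: "\<And>x y. x \<in> L \<Longrightarrow> y \<in> L \<Longrightarrow> x + y \<in> L"
    and neg: "\<And>x. x \<in> L \<Longrightarrow> - x \<in> L" and inv: "\<And>u x. x \<in> L \<Longrightarrow> A u x \<in> L"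
    and "u \<noteq> 0" "x - A u x \<in> L"
  shows "x \<in> L"
proof -
  define V where "V = {v. \<forall>t. t *\<^sub>R v \<in> L}"
  have V: "subspace V"
    unfolding subspace_def by (auto simp: V_def z add scaleR_add_right)
  have VL: "v \<in> L" if "v \<in> V" for v
    using that by (auto simp: V_def dest: spec[of _ 1])
  have VA: "v - A s v \<in> V" if "v \<in> V" for v s
  proof -
    have "A s v \<in> V" using that inv by (fastforce simp: V_def simp flip: A_arith(5))
    then show ?thesis using V that by (intro subspace_diff)
  qed
  have V_preimage: "w \<in> V" if "s \<noteq> 0" "w - A s w \<in> V" for s w
    by (rule subspace_injective_preimage[OF linear_diff_A inj_diff_A[OF that(1)] V VA that(2)])
  have diffL: "v - w \<in> L" if "v \<in> L" "w \<in> L" for v w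
    using add[OF that(1) neg[OF that(2)]] by simp
  have decomp: "\<exists>y z. y \<in> V \<and> (\<forall>w\<in>V. orthogonal z w) \<and> v = y + z" for v
  proof -
    obtain y z where "y \<in> span V" "\<And>w. w \<in> span V \<Longrightarrow> orthogonal z w" "v = y + z"
      using orthogonal_subspace_decomp_exists[of V v] by blast
    then show ?thesis using span_eq_iff[THEN iffD2, OF V] by auto
  qed
  have "L \<subseteq> V"
  proof (rule ccontr)
    assume "\<not> L \<subseteq> V"
    then obtain v where v: "v \<in> L" "v \<notin> V" by blast
    obtain p q where pq: "p \<in> V" "v = p + q" using decomp by blast
    have q: "q \<in> L" "q \<notin> V"
      using diffL[OF v(1) VL[OF pq(1)]] subspace_add[OF V pq(1)] v(2) pq(2) by auto
    \<comment> \<open>Small nonzero times: \<open>q - A (s k) q\<close> tends to 0 but never lies in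
      \<open>V\<close>, so its component orthogonal to \<open>V\<close> is a small nonzero element
      of \<open>L\<close>.\<close>
    define s where "s k = inverse (real (Suc k))" for k
    have "\<forall>k. \<exists>y z. y \<in> V \<and> (\<forall>w\<in>V. orthogonal z w) \<and> q - A (s k) q = y + z"
      using decomp by blast
    then obtain y r where "\<forall>k. y k \<in> V \<and> (\<forall>w\<in>V. orthogonal (r k) w) \<and> q - A (s k) q = y k + r k"
      unfolding choice_iff by blast
    then have yr: "\<And>k. y k \<in> V" "\<And>k w. w \<in> V \<Longrightarrow> orthogonal (r k) w"
        "\<And>k. q - A (s k) q = y k + r k"
      by auto
    have rL: "r k \<in> L" for k
      using diffL[OF diffL[OF q(1) inv[OF q(1)]] VL[OF yr(1)], of "s k" k] yr(3)[of k] by simp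
    have r0: "r k \<noteq> 0" for k
    proof
      assume "r k = 0"
      then have "q - A (s k) q \<in> V" using yr(1,3)[of k] by simp
      then show False using V_preimage[of "s k" q] q(2) by (simp add: s_def)
    qed
    have r_le: "norm (r k) \<le> norm (q - A (s k) q)" for k
    proof -
      have "orthogonal (y k) (r k)" using yr(1,2) orthogonal_commute by blast
      then have "norm (q - A (s k) q) ^ 2 = norm (y k) ^ 2 + norm (r k) ^ 2"
        by (simp add: yr(3) norm_add_Pythagorean)
      then have "norm (r k) ^ 2 \<le> norm (q - A (s k) q) ^ 2"
        using zero_le_power2[of "norm (y k)"] by linarith
      then show ?thesis by (rule power2_le_imp_le) (rule norm_ge_zero)
    qed
    have "s \<longlonglongrightarrow> 0"
      unfolding s_def by (rule LIMSEQ_inverse_real_of_nat)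
    moreover have "isCont (\<lambda>t. q - A t q) 0"
    proof -
      have "continuous_on UNIV (\<lambda>t. q - A t q)" by (intro continuous_intros)
      then show ?thesis by (simp add: continuous_on_eq_continuous_at)
    qed
    ultimately have "(\<lambda>k. q - A (s k) q) \<longlonglongrightarrow> q - A 0 q"
      using isCont_tendsto_compose by blast
    then have "(\<lambda>k. norm (q - A (s k) q)) \<longlonglongrightarrow> 0"
      by (simp add: tendsto_norm_zero)
    then have r_lim: "r \<longlonglongrightarrow> 0"
      by (rule Lim_null_comparison[OF always_eventually, rotated]) (simp add: r_le)
    have "r k /\<^sub>R norm (r k) \<in> sphere 0 1" for k
      using r0 by simp
    then obtain d \<rho> where d: "d \<in> sphere 0 1" "strict_mono (\<rho> :: nat \<Rightarrow> nat)"
        "((\<lambda>k. r k /\<^sub>R norm (r k)) \<circ> \<rho>) \<longlonglongrightarrow> d"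
      using seq_compactE[of "sphere 0 1" "\<lambda>k. r k /\<^sub>R norm (r k)"] compact_sphere[of "0 :: real^'d" 1]
      by (auto simp: compact_eq_seq_compact_metric)
    have "t *\<^sub>R d \<in> L" for t
      by (rule closed_subgroup_contains_limit_line[where q = "r \<circ> \<rho>", OF \<open>closed L\<close> z add neg])
        (use rL r0 LIMSEQ_subseq_LIMSEQ[OF r_lim d(2)] d(3) in \<open>auto simp: o_def\<close>)
    then have "d \<in> V" by (simp add: V_def)
    \<comment> \<open>The limit direction \<open>d\<close> spans a line in \<open>L\<close>, so it
      lies in \<open>V\<close>, yet it is a limit of unit vectors orthogonal to
      \<open>V\<close>.\<close>
    have "r k \<bullet> d = 0" for k
      using yr(2)[OF \<open>d \<in> V\<close>, of k] by (simp add: orthogonal_def)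
    then have "(\<lambda>k::nat. 0) \<longlonglongrightarrow> d \<bullet> d"
      using tendsto_inner[OF d(3) tendsto_const[of d]] by simp
    then have "d \<bullet> d = 0" by (simp add: LIMSEQ_const_iff)
    then show False using d(1) by simp
  qed
  then have "x \<in> V" using V_preimage assms(6,7) by blast
  then show ?thesis by (rule VL)
qed

end

section \<open>Cocycles in the semidirect product\<close>

locale sd_cocycle = linear_flow A + rot_cocycle a "sd_mult A" "sd_inv A" F
  for A :: "real \<Rightarrow> real^'d \<Rightarrow> real^'d" and a :: "'x::{topological_group_add, metric_space}"
    and F :: "int \<Rightarrow> 'x \<Rightarrow> (real^'d) \<times> real"
begin

lemma fst_cocycle: "fst (F (m + n) x) = fst (F m (T n x)) + A (snd (F m (T n x))) (fst (F n x))"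
  and snd_cocycle: "snd (F (m + n) x) = snd (F m (T n x)) + snd (F n x)"
  by (simp_all add: cocycle sd_mult_def)

lemma real_part: "rot_cocycle a (+) uminus (\<lambda>n x. snd (F n x))"
proof unfold_locales
  show "continuous_on UNIV (\<lambda>x. snd (F n x))" for n
    by (intro continuous_intros)
  fix V :: "real set" and U :: "'x set"
  assume "open V" "0 \<in> V" "open U" "U \<noteq> {}"
  then have "open (UNIV \<times> V :: ((real^'d) \<times> real) set)" "0 \<in> (UNIV \<times> V :: ((real^'d) \<times> real) set)"
    by (auto simp: zero_prod_def intro: open_Times)
  from recurrent[OF this \<open>open U\<close> \<open>U \<noteq> {}\<close>]
  show "\<exists>n y. n \<noteq> 0 \<and> y \<in> U \<and> T n y \<in> U \<and> snd (F n y) \<in> V"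
    by (auto simp: mem_Times_iff)
qed (auto simp: snd_cocycle intro!: continuous_intros)

text \<open>Conjugating by \<open>(0, \<psi>)\<close> turns \<open>F\<close> into a cocycle with values in the vector group.\<close>

lemma orb_surj_if_coboundary:
  assumes \<psi>: "continuous_on UNIV \<psi>" and snd_F: "\<And>n x. snd (F n x) = \<psi> (T n x) - \<psi> x"
  shows "\<exists>x. fst ` orb x = UNIV"
proof -
  have cont_\<psi> [continuous_intros]: "continuous_on S (\<lambda>x. \<psi> (h x))" if "continuous_on S h" for S and h :: "'b::topological_space \<Rightarrow> 'x"
    using continuous_on_compose2[OF \<psi> that] by simp
  define H where "H n x = A (- \<psi> (T n x)) (fst (F n x))" for n x
  interpret B: rot_cocycle a "(+)" uminus H
  proof unfold_locales
    show "continuous_on UNIV (H n)" for n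
      unfolding H_def by (intro continuous_intros)
    show "H (m + n) x = H m (T n x) + H n x" for m n x
    proof -
      have "- \<psi> (T (m + n) x) + snd (F m (T n x)) = - \<psi> (T n x)"
        by (simp add: snd_F rot_pow_add)
      then show ?thesis
        by (simp add: H_def fst_cocycle rot_pow_add flip: A_add)
    qed
    fix V :: "(real^'d) set" and U :: "'x set"
    assume V: "open V" "0 \<in> V" and U: "open U" "U \<noteq> {}"
    \<comment> \<open>The vectors sent into \<open>V\<close> by \<open>A (- s)\<close> for every
      \<open>s\<close> in the range of \<open>\<psi>\<close>. Compactness of that range makes the
      set open, so recurrence of \<open>F\<close> passes to \<open>H\<close>.\<close>
    define V0 where "V0 = - {v. \<exists>s\<in>range \<psi>. (v, s) \<in> (\<lambda>p. A (- snd p) (fst p)) -` (- V)}"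
    have "compact (range \<psi>)"
      by (rule compact_continuous_image[OF \<psi> compact_space])
    moreover have "closed ((\<lambda>p. A (- snd p) (fst p)) -` (- V))"
      using V by (intro closed_vimage) (auto intro!: continuous_intros)
    ultimately have "open V0"
      unfolding V0_def by (intro open_Compl closed_proj_compact)
    then have "open (V0 \<times> (UNIV :: real set))" by (intro open_Times) auto
    moreover have "0 \<in> V0 \<times> (UNIV :: real set)" using V by (simp add: V0_def zero_prod_def)
    ultimately have "\<exists>n y. n \<noteq> 0 \<and> y \<in> U \<and> T n y \<in> U \<and> F n y \<in> V0 \<times> UNIV"
      using U by (rule recurrent)
    then obtain n y where n: "n \<noteq> 0" "y \<in> U" "T n y \<in> U" "F n y \<in> V0 \<times> UNIV"
      by (elim exE conjE)
    then have "H n y \<in> V" by (auto simp: V0_def H_def mem_Times_iff)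
    then show "\<exists>n y. n \<noteq> 0 \<and> y \<in> U \<and> T n y \<in> U \<and> H n y \<in> V" using n by blast
  qed (auto intro!: continuous_intros)
  obtain x where x: "fst ` B.orb x = UNIV"
    using B.abelian_orb_surj[OF add.commute] by blast
  \<comment> \<open>Undoes the conjugation, with heights normalised to vanish at \<open>x\<close>,
    so that orbit points go to orbit points.\<close>
  let ?h = "\<lambda>p. (fst p, (A (\<psi> (fst p)) (snd p), \<psi> (fst p) - \<psi> x))"
  have img: "?h p \<in> orb x" if "p \<in> B.orb x" for p
  proof (rule B.orb_map[OF that, where h = ?h])
    show "continuous_on UNIV ?h" by (intro continuous_intros)
    show "?h (T n x, H n x) \<in> orb x" for n
      using orb_mem[of n x] by (simp add: H_def prod_eq_iff flip: snd_F)
  qed (rule closed_orb)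
  have "y \<in> fst ` orb x" for y
  proof -
    have "y \<in> fst ` B.orb x" by (simp add: x)
    then obtain p where "p \<in> B.orb x" "y = fst p" by blast
    then show ?thesis using img[of p] by (auto intro!: image_eqI[of _ _ "?h p"])
  qed
  then show ?thesis by blast
qed

end

locale expansive_cocycle = expansive_flow A + sd_cocycle A a F
  for A :: "real \<Rightarrow> real^'d \<Rightarrow> real^'d" and a :: "'x::{topological_group_add, metric_space}"
    and F :: "int \<Rightarrow> 'x \<Rightarrow> (real^'d) \<times> real"
begin

sublocale R: rot_cocycle a "(+)" uminus "\<lambda>n x. snd (F n x)"
  by (rule real_part)

lemma conj_vertical: "sd_mult A (sd_mult A g (v, 0)) (sd_inv A g) = (A (snd g) v, 0)"
  by (simp add: sd_mult_def sd_inv_def)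

lemma mult_inv_same_height: "sd_mult A (p, s) (sd_inv A (q, s)) = (p - q, 0)"
  by (simp add: sd_mult_def sd_inv_def)

text \<open>Required at all points at once so that \<open>vertical \<times> {0}\<close> can be the
  subgroup \<open>L\<close> of \<open>bounded_mod_subgroup\<close>; by \<open>ess_vertical_0\<close>
  nothing is lost at an \<open>R.good\<close> point.\<close>

definition vertical :: "(real^'d) set" where
  "vertical = {v. \<forall>y. (v, 0) \<in> ess y}"

lemma closed_vertical: "closed vertical"
proof -
  have "closed ((\<lambda>v. (v, 0)) -` ess y)" for y
    by (rule closed_vimage[OF closed_ess]) (intro continuous_intros)
  then have "closed (\<Inter>y. (\<lambda>v. (v, 0)) -` ess y)" by (intro closed_INT) auto
  also have "\<dots> = vertical" by (auto simp: vertical_def)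
  finally show ?thesis .
qed

section \<open>The case of a real part with every real number essential\<close>

context
  assumes transitive: "\<And>x. R.ess x = UNIV"
begin

lemma R_orb: "R.orb x = UNIV" if x: "R.good x"
proof -
  have "(y, u) \<in> R.orb x" for y u
  proof -
    have "closed ((\<lambda>y. (y, u)) -` R.orb x)"
      by (rule closed_vimage[OF R.closed_orb]) (intro continuous_intros)
    moreover have "T n x \<in> (\<lambda>y. (y, u)) -` R.orb x" for n
    proof -
      have "(x, u - snd (F n x)) \<in> R.orb x" using x transitive[of x] by (simp add: R.good_def)
      from R.orb_append[OF R.orb_mem[of n] this] show ?thesis by simp
    qed
    ultimately have "y \<in> (\<lambda>y. (y, u)) -` R.orb x" by (rule dense_orbit_closed)
    then show ?thesis by simp
  qed
  then show ?thesis by auto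
qed

text \<open>Conjugating \<open>(v, 0)\<close> by \<open>F n x\<close> depends only on the height of
  \<open>F n x\<close>, and the pairs of \<open>T n x\<close> and this height are dense by
  \<open>R_orb\<close>.\<close>

lemma ess_vertical:
  assumes x: "R.good x" and v: "(v, 0) \<in> ess x"
  shows "A u v \<in> vertical"
  unfolding vertical_def
proof (intro CollectI allI)
  fix y
  have "(y, u) \<in> closure (range (\<lambda>n. (T n x, snd (F n x))))"
    using R_orb[OF x] by (simp add: R.orb_def)
  then show "(A u v, 0) \<in> ess y"
  proof (rule ess_cont_limit[where k = "\<lambda>u. (A u v, 0)"])
    show "continuous_on UNIV (\<lambda>u. (A u v, 0::real))" by (intro continuous_intros)
    show "(A (snd (F n x)) v, 0) \<in> ess (T n x)" for n
      using ess_conj[OF v, of n] by (simp add: conj_vertical)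
  qed
qed

lemma ess_vertical_0: "R.good x \<Longrightarrow> (v, 0) \<in> ess x \<Longrightarrow> v \<in> vertical"
  using ess_vertical[of x v 0] by simp

lemma meagre_exceptions:
  obtains \<G> where "countable \<G>" "\<And>S. S \<in> \<G> \<Longrightarrow> closed S \<and> interior S = {}"
    "\<And>x. x \<notin> \<Union>\<G> \<Longrightarrow> good x \<and> R.good x"
proof -
  obtain \<G> where G: "countable \<G>" "\<And>S. S \<in> \<G> \<Longrightarrow> closed S \<and> interior S = {}" "\<And>x. x \<notin> \<Union>\<G> \<Longrightarrow> good x"
    by (rule bad_points_meagre) blast
  obtain \<H> where H: "countable \<H>" "\<And>S. S \<in> \<H> \<Longrightarrow> closed S \<and> interior S = {}" "\<And>x. x \<notin> \<Union>\<H> \<Longrightarrow> R.good x"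
    by (rule R.bad_points_meagre) blast
  show thesis
    by (rule that[of "\<G> \<union> \<H>"]) (use G H in auto)
qed

lemma ex_both_good: "\<exists>x. good x \<and> R.good x"
proof (rule ccontr)
  assume none: "\<nexists>x. good x \<and> R.good x"
  obtain \<G> where G: "countable \<G>" "\<And>S. S \<in> \<G> \<Longrightarrow> closed S \<and> interior S = {}"
      "\<And>x. x \<notin> \<Union>\<G> \<Longrightarrow> good x \<and> R.good x"
    by (rule meagre_exceptions) blast
  have "\<Union>\<G> = UNIV" using G(3) none by auto
  then show False using Baire_compact_cover[OF compact_space G(1)] G(2) by auto
qed

lemma vertical_add:
  assumes "v \<in> vertical" "w \<in> vertical"
  shows "v + w \<in> vertical"
proof -
  obtain x where x: "good x" "R.good x" using ex_both_good by blast
  have "sd_mult A (v, 0) (w, 0) \<in> ess x"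
    using assms by (intro good_ess_mul x) (auto simp: vertical_def)
  then show ?thesis by (intro ess_vertical_0[OF x(2)]) (simp add: sd_mult_def)
qed

lemma vertical_uminus:
  assumes "v \<in> vertical"
  shows "- v \<in> vertical"
  unfolding vertical_def
proof (intro CollectI allI)
  fix y
  have "sd_inv A (v, 0) \<in> ess y" using assms by (intro ess_iv) (simp add: vertical_def)
  then show "(- v, 0) \<in> ess y" by (simp add: sd_inv_def)
qed

lemma vertical_0: "0 \<in> vertical"
  using ess_0 by (simp add: vertical_def zero_prod_def)

lemma vertical_A:
  assumes "v \<in> vertical"
  shows "A u v \<in> vertical"
proof -
  obtain x where x: "R.good x" using ex_both_good by blast
  show ?thesis using assms by (intro ess_vertical[OF x]) (simp add: vertical_def)
qed

lemma vertical_diff_A: "u \<noteq> 0 \<Longrightarrow> v - A u v \<in> vertical \<Longrightarrow> v \<in> vertical"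
  by (rule invariant_subgroup_diff_A[OF closed_vertical vertical_0 vertical_add vertical_uminus vertical_A])

text \<open>Otherwise \<open>bounded_mod_subgroup\<close> with \<open>vertical \<times> {0}\<close>
  confines the heights of \<open>F n x\<close> to a compact set, contradicting
  \<open>R_orb\<close>.\<close>

lemma small_ess_nonzero_height:
  assumes x: "R.good x" and "e > 0"
  shows "\<exists>g\<in>ess x. norm g \<le> e \<and> snd g \<noteq> 0"
proof (rule ccontr)
  assume none: "\<not> ?thesis"
  define L where "L = vertical \<times> {0::real}"
  have small: "g \<in> L" if g: "g \<in> ess x" "norm g \<le> e" for g
  proof -
    have "snd g = 0" using none g by blast
    then have "(fst g, 0) \<in> ess x" using g(1) by (cases g) simp
    from ess_vertical_0[OF x this] show ?thesis
      using \<open>snd g = 0\<close> by (simp add: L_def mem_Times_iff)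
  qed
  have L1: "closed L" unfolding L_def by (intro closed_Times closed_vertical) auto
  have L2: "0 \<in> L" by (simp add: L_def zero_prod_def vertical_0)
  have L3: "sd_mult A g h \<in> L" if "g \<in> L" "h \<in> L" for g h
    using that vertical_add by (auto simp: L_def sd_mult_def)
  have L4: "sd_inv A g \<in> L" if "g \<in> L" for g
    using that vertical_uminus by (auto simp: L_def sd_inv_def)
  have L5: "sd_mult A (sd_mult A g l) (sd_inv A g) \<in> L" if l: "l \<in> L" for g l
  proof -
    obtain v where "l = (v, 0)" "v \<in> vertical" using l by (auto simp: L_def)
    then show ?thesis using vertical_A by (simp add: conj_vertical L_def)
  qed
  have L6: "L \<subseteq> ess y" for y by (auto simp: L_def vertical_def)
  obtain K where K: "compact K" "\<And>n. \<exists>k\<in>K. \<exists>l\<in>L. F n x = sd_mult A k l"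
    by (rule bounded_mod_subgroup[OF L1 L2 L3 L4 L5 L6 \<open>e > 0\<close> small]) blast+
  have "snd (F n x) \<in> snd ` K" for n
  proof -
    obtain k l where "k \<in> K" "l \<in> L" "F n x = sd_mult A k l" using K(2) by blast
    then show ?thesis by (auto simp: sd_mult_def L_def intro!: image_eqI[of _ _ k])
  qed
  moreover have cK: "compact (snd ` K)"
    using K(1) by (intro compact_continuous_image continuous_intros)
  ultimately have "u \<in> snd ` K" for u
    using R.orb_map[OF _ continuous_on_snd[OF continuous_on_id], of "(x, u)" x "snd ` K"] R_orb[OF x]
    by (simp add: compact_imp_closed)
  then have "snd ` K = UNIV" by blast
  then show False using compact_imp_bounded[OF cK] by simp
qed

text \<open>Commutators have height 0, so those of essential values are vertical. The commutator
  here is \<open>d - A u1 d\<close> with \<open>d = v - (w - A u w)\<close>, and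
  \<open>vertical_diff_A\<close> then gives \<open>d\<close> itself.\<close>

lemma ess_centralizer:
  assumes x: "good x" "R.good x" and u1: "u1 \<noteq> 0" "(w - A u1 w, u1) \<in> ess x" and v: "(v, u) \<in> ess x"
  shows "v - (w - A u w) \<in> vertical"
proof -
  let ?g = "(v, u)" and ?h = "(w - A u1 w, u1)"
  have "sd_mult A (sd_mult A ?g ?h) (sd_inv A (sd_mult A ?h ?g)) \<in> ess x"
    by (intro good_ess_mul ess_iv x u1 v)
  moreover have "sd_mult A ?g ?h = (v + A u w - A (u1 + u) w, u + u1)"
      "sd_mult A ?h ?g = (w - A u1 w + A u1 v, u + u1)"
    using A_add[of u u1 w] by (simp_all add: sd_mult_def add.commute)
  ultimately have "(v + A u w - A (u1 + u) w - (w - A u1 w + A u1 v), 0) \<in> ess x"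
    by (simp only: mult_inv_same_height)
  then have "v + A u w - A (u1 + u) w - (w - A u1 w + A u1 v) \<in> vertical"
    by (rule ess_vertical_0[OF x(2)])
  also have "v + A u w - A (u1 + u) w - (w - A u1 w + A u1 v)
      = (v - (w - A u w)) - A u1 (v - (w - A u w))"
    by (simp add: A_add)
  finally show ?thesis by (rule vertical_diff_A[OF u1(1)])
qed

text \<open>One essential value of nonzero height determines \<open>w\<close>. By
  \<open>ess_centralizer\<close> every other one lies on the same line modulo vertical values, so
  the heights form a closed subgroup with arbitrarily small elements.\<close>

lemma ess_contains_line:
  assumes x: "good x" "R.good x"
  shows "\<exists>w. \<forall>u. (w - A u w, u) \<in> ess x"
proof -
  obtain g where g: "g \<in> ess x" "snd g \<noteq> 0"
    using small_ess_nonzero_height[OF x(2), of 1] by auto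
  obtain w where w: "w - A (snd g) w = fst g" using surj_diff_A[OF g(2)] by blast
  have on_line: "(w - A u w, u) \<in> ess x" if vu: "(v, u) \<in> ess x" for v u
  proof -
    have "v - (w - A u w) \<in> vertical"
      using ess_centralizer[OF x g(2) _ vu] g(1) w by simp
    from vertical_uminus[OF this] have "(- (v - (w - A u w)), 0) \<in> ess x" unfolding vertical_def by blast
    from good_ess_mul[OF x(1) this vu] show ?thesis by (simp add: sd_mult_def)
  qed
  define S where "S = {u. (w - A u w, u) \<in> ess x}"
  have "S = UNIV"
  proof (rule closed_subgroup_real_UNIV)
    have "closed ((\<lambda>u. (w - A u w, u)) -` ess x)"
      by (rule closed_vimage[OF closed_ess]) (intro continuous_intros)
    then show "closed S" by (simp add: S_def vimage_def)
    show "0 \<in> S" using ess_0 by (simp add: S_def zero_prod_def)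
    show "s + t \<in> S" if "s \<in> S" "t \<in> S" for s t
    proof -
      have "sd_mult A (w - A s w, s) (w - A t w, t) \<in> ess x"
        using that by (intro good_ess_mul x) (auto simp: S_def)
      then show ?thesis by (simp add: S_def sd_mult_def A_add)
    qed
    show "- s \<in> S" if "s \<in> S" for s
    proof -
      have "sd_inv A (w - A s w, s) \<in> ess x" using that by (intro ess_iv) (simp add: S_def)
      then show ?thesis by (simp add: S_def sd_inv_def)
    qed
    show "\<exists>s\<in>S. s \<noteq> 0 \<and> \<bar>s\<bar> \<le> e" if "e > 0" for e
    proof -
      obtain h where h: "h \<in> ess x" "norm h \<le> e" "snd h \<noteq> 0"
        using small_ess_nonzero_height[OF x(2) \<open>e > 0\<close>] by blast
      have "snd h \<in> S" using on_line[of "fst h" "snd h"] h(1) by (simp add: S_def)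
      moreover have "\<bar>snd h\<bar> \<le> e" using norm_snd_le[of "snd h" "fst h"] h(2) by simp
      ultimately show ?thesis using h(3) by blast
    qed
  qed
  then show ?thesis by (auto simp: S_def)
qed

lemma orb_surj_if_transitive: "\<exists>x. fst ` orb x = UNIV"
proof -
  obtain \<G> where G: "countable \<G>" "\<And>S. S \<in> \<G> \<Longrightarrow> closed S \<and> interior S = {}"
      "\<And>x. x \<notin> \<Union>\<G> \<Longrightarrow> good x \<and> R.good x"
    by (rule meagre_exceptions) blast
  define E where "E C = {x. \<exists>w\<in>cball 0 (real C). \<forall>u. (w - A u w, u) \<in> ess x}" for C :: nat
  have "closed (E C)" for C
  proof -
    have "closed {p. (snd p - A u (snd p), u) \<in> ess (fst p)}" for u
      by (rule ess_closed_graph[where h = "\<lambda>w. (w - A u w, u)"]) (intro continuous_intros)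
    then have "closed (\<Inter>u. {p. (snd p - A u (snd p), u) \<in> ess (fst p)})"
      by (intro closed_INT) auto
    then have "closed {x. \<exists>w\<in>cball 0 (real C). (x, w) \<in> (\<Inter>u. {p. (snd p - A u (snd p), u) \<in> ess (fst p)})}"
      by (intro closed_proj_compact compact_cball)
    then show ?thesis by (simp add: E_def)
  qed
  moreover have "\<Union>(\<G> \<union> range E) = UNIV"
  proof -
    have "x \<in> \<Union>(\<G> \<union> range E)" for x
    proof (cases "x \<in> \<Union>\<G>")
      case False
      then have "\<exists>w. \<forall>u. (w - A u w, u) \<in> ess x"
        using G(3)[of x] by (intro ess_contains_line) simp_all
      then obtain w where w: "\<forall>u. (w - A u w, u) \<in> ess x"
        by (rule exE)
      obtain C where "norm w \<le> real C" using real_arch_simple by blast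
      then have "x \<in> E C" using w by (auto simp: E_def intro!: bexI[of _ w])
      then show ?thesis by blast
    qed auto
    then show ?thesis by blast
  qed
  ultimately have "\<exists>S\<in>\<G> \<union> range E. interior S \<noteq> {}"
    using G(1,2) by (intro Baire_compact_cover[OF compact_space]) auto
  then obtain C where C: "interior (E C) \<noteq> {}" using G(2) by auto
  obtain J where J: "finite J" "\<And>y. \<exists>j\<in>J. T j y \<in> interior (E C)"
    by (rule finite_translates_cover[OF open_interior C]) blast
  obtain x where x: "good x" "R.good x" using ex_both_good by blast
  obtain w1 where w1: "\<And>u. (w1 - A u w1, u) \<in> ess x" using ess_contains_line[OF x] by blast
  define K0 where "K0 = cball (0::real^'d) (real C + norm w1) \<times> {0::real}"
  have fibre: "\<exists>k\<in>K0. (T n x, k) \<in> orb x" if "T n x \<in> interior (E C)" for n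
  proof -
    have "T n x \<in> E C" using that interior_subset by blast
    then obtain w' where w': "norm w' \<le> real C" "\<And>u. (w' - A u w', u) \<in> ess (T n x)"
      by (auto simp: E_def)
    obtain b \<phi> where F: "F n x = (b, \<phi>)" by (cases "F n x")
    \<comment> \<open>The vector \<open>w'\<close> at \<open>T n x\<close> pulled back to
      \<open>x\<close> along \<open>F n x\<close>; equivalently
      \<open>w' = b + A \<phi> w\<close>.\<close>
    define w where "w = A (- \<phi>) (w' - b)"
    have w: "(w - A u w, u) \<in> ess x" for u
    proof -
      have "A (u - \<phi>) v = A u (A (- \<phi>) v)" "A (- \<phi>) (A u v) = A u (A (- \<phi>) v)" for v
        by (simp_all add: add.commute flip: A_add)
      then have "sd_mult A (sd_mult A (sd_inv A (b, \<phi>)) (w' - A u w', u)) (b, \<phi>) = (w - A u w, u)"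
        by (simp add: sd_mult_def sd_inv_def w_def)
      then show ?thesis
        using ess_conj[OF w'(2), of "- n" u] by (simp add: F_uminus F)
    qed
    \<comment> \<open>The lines through \<open>w\<close> and \<open>w1\<close> are compared at
      height 1, where any nonzero height would do.\<close>
    have "(w - A 1 w) - (w1 - A 1 w1) \<in> vertical"
      by (rule ess_centralizer[OF x one_neq_zero w1 w])
    then have "(w - w1) - A 1 (w - w1) \<in> vertical" by (simp add: algebra_simps)
    then have "w - w1 \<in> vertical" by (rule vertical_diff_A[rotated]) simp
    then have "(x, (w - w1, 0)) \<in> orb x" using x(1) by (simp add: good_def vertical_def)
    moreover have "(x, (w - A (- \<phi>) w, - \<phi>)) \<in> orb x" using x(1) w by (simp add: good_def)
    \<comment> \<open>The element of height \<open>- \<phi>\<close> on the line cancels the height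
      of \<open>F n x\<close> and leaves \<open>(w' - w, 0)\<close>; the vertical correction
      replaces the uncontrolled \<open>w\<close> by the fixed \<open>w1\<close>.\<close>
    ultimately have "(T n x, sd_mult A (sd_mult A (b, \<phi>) (w - A (- \<phi>) w, - \<phi>)) (w - w1, 0)) \<in> orb x"
      using orb_mem[of n x] by (intro orb_append) (simp_all add: F)
    moreover have "sd_mult A (sd_mult A (b, \<phi>) (w - A (- \<phi>) w, - \<phi>)) (w - w1, 0) = (w' - w1, 0)"
      by (simp add: sd_mult_def w_def)
    moreover have "(w' - w1, 0) \<in> K0"
      using w'(1) norm_triangle_ineq4[of w' w1] by (simp add: K0_def)
    ultimately show ?thesis by auto
  qed
  define K where "K = (\<Union>j\<in>J. (\<lambda>p. sd_mult A (F (- j) (fst p)) (snd p)) ` (UNIV \<times> K0))"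
  have "compact K0" unfolding K0_def by (intro compact_Times compact_cball) auto
  then have "compact K"
    unfolding K_def using J(1)
    by (intro compact_UN compact_continuous_image compact_Times compact_space) (auto intro!: continuous_intros)
  moreover have "\<exists>k\<in>K. (T n x, k) \<in> orb x" for n
  proof -
    obtain j where j: "j \<in> J" "T j (T n x) \<in> interior (E C)" using J(2) by blast
    then obtain k where k: "k \<in> K0" "(T j (T n x), k) \<in> orb x"
      using fibre[of "j + n"] by (auto simp: rot_pow_add)
    have "(T n x, sd_mult A (F (- j) (T j (T n x))) k) \<in> orb x"
      using orb_invariant[OF k(2), of "- j"] by simp
    moreover have "sd_mult A (F (- j) (T j (T n x))) k \<in> K"
      unfolding K_def using j k
      by (intro UN_I[of j] image_eqI[of _ _ "(T j (T n x), k)"]) auto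
    ultimately show ?thesis by blast
  qed
  ultimately show ?thesis using orb_surj_if_bounded by blast
qed

end

lemma ex_orb_surj: "\<exists>x. fst ` orb x = UNIV"
  using real_cocycle_dichotomy[OF real_part]
proof
  assume "\<forall>x. R.ess x = UNIV"
  then show ?thesis by (intro orb_surj_if_transitive) simp
next
  assume "\<exists>\<psi>. continuous_on UNIV \<psi> \<and> (\<forall>n x. snd (F n x) = \<psi> (T n x) - \<psi> x)"
  then show ?thesis using orb_surj_if_coboundary by blast
qed

end

section \<open>The concrete cocycle and its identity over all integer times\<close>

context linear_flow
begin

interpretation topological_group_on "sd_mult A" "sd_inv A"
  by (rule sd_group)

text \<open>Splits off the earliest factor instead of the latest one; at negative times this is the
  factor that a step forward removes.\<close>

lemma cocycle_nat_shift:
  "cocycle_nat A a f (Suc n) x = sd_mult A (cocycle_nat A a f n (rot_pow a 1 x)) (f x)"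
proof (induction n)
  case 0
  then show ?case by (simp add: sd_unit_def flip: zero_prod_def)
next
  case (Suc n)
  have "rot_pow a (int (Suc n)) x = rot_pow a (int n) (rot_pow a 1 x)"
    using rot_pow_add[of a "int n" 1 x] by (simp add: add.commute)
  then show ?case
    using Suc by (simp add: mul_assoc)
qed

lemma cocycle_Suc: "cocycle A a f (n + 1) x = sd_mult A (f (rot_pow a n x)) (cocycle A a f n x)"
proof (cases "0 \<le> n")
  case True
  then show ?thesis by (simp add: cocycle_def nat_add_distrib)
next
  case False
  define k where "k = nat (- n - 1)"
  define y where "y = rot_pow a n x"
  have k: "nat (- n) = Suc k" "nat (- (n + 1)) = k" using False by (auto simp: k_def)
  have y: "rot_pow a (n + 1) x = rot_pow a 1 y"
    using rot_pow_add[of a 1 n x] by (simp add: y_def add.commute)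
  have "cocycle A a f (n + 1) x = sd_inv A (cocycle_nat A a f k (rot_pow a 1 y))"
  proof (cases "n = - 1")
    case True
    then show ?thesis by (simp add: cocycle_def k_def sd_unit_def flip: zero_prod_def)
  next
    case neq: False
    then show ?thesis using False by (simp add: cocycle_def y k_def)
  qed
  moreover have "cocycle A a f n x
      = sd_inv A (sd_mult A (cocycle_nat A a f k (rot_pow a 1 y)) (f y))"
    using False by (simp add: cocycle_def k cocycle_nat_shift y_def del: cocycle_nat.simps)
  ultimately show ?thesis by (simp add: iv_mul y_def)
qed

lemma cocycle_add:
  "cocycle A a f (m + n) x = sd_mult A (cocycle A a f m (rot_pow a n x)) (cocycle A a f n x)"
proof (induction m rule: int_induct[where k = 0])
  case base
  then show ?case by (simp add: cocycle_def[of A a f 0] sd_unit_def flip: zero_prod_def)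
next
  case (step1 i)
  then show ?case
    using cocycle_Suc[of a f "i + n" x] cocycle_Suc[of a f i "rot_pow a n x"]
    by (simp add: ac_simps mul_assoc rot_pow_add)
next
  case (step2 i)
  have *: "cocycle A a f (j - 1) z = sd_mult A (sd_inv A (f (rot_pow a (j - 1) z))) (cocycle A a f j z)" for j z
    using cocycle_Suc[of a f "j - 1" z] by simp
  have "rot_pow a (i - 1 + n) x = rot_pow a (i - 1) (rot_pow a n x)"
    by (rule rot_pow_add)
  then show ?case
    using *[of "i + n" x] *[of i "rot_pow a n x"] step2 by (simp add: algebra_simps mul_assoc)
qed

lemma continuous_on_cocycle:
  fixes f :: "'x::topological_group_add \<Rightarrow> (real^'d) \<times> real"
  assumes f: "continuous_on UNIV f"
  shows "continuous_on UNIV (cocycle A a f n)"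
proof -
  have cont_f: "continuous_on UNIV (\<lambda>x. f (rot_pow a m x))" for m
    by (intro continuous_on_compose2[OF f] continuous_intros) auto
  have cont_nat: "continuous_on UNIV (cocycle_nat A a f m)" for m
    by (induction m) (simp_all add: sd_unit_def, intro continuous_intros cont_f)
  have "continuous_on UNIV (\<lambda>x. cocycle_nat A a f m (rot_pow a k x))" for m k
    by (intro continuous_on_compose2[OF cont_nat] continuous_intros) auto
  then show ?thesis
    unfolding cocycle_def by (cases "0 \<le> n") (auto intro!: cont_nat continuous_intros)
qed

end

lemma finite_orbit_if_periodic:
  assumes "n \<noteq> 0" "rot_pow a n 0 = 0"
  shows "finite (range (\<lambda>k. rot_pow a k 0))"
proof -
  define N where "N = \<bar>n\<bar>"
  have N: "N > 0" "rot_pow a N 0 = 0"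
    using assms by (auto simp: N_def abs_if rot_pow_uminus)
  have mult: "rot_pow a (q * N) 0 = 0" for q
    by (induction q rule: int_induct[where k = 0])
      (simp_all add: distrib_right left_diff_distrib rot_pow_add rot_pow_diff N)
  have "rot_pow a k 0 = rot_pow a (k mod N) 0" for k
    using rot_pow_add[of a "k mod N" "k div N * N" 0] by (simp add: mult)
  then have "range (\<lambda>k. rot_pow a k 0) \<subseteq> (\<lambda>k. rot_pow a k 0) ` {0..<N}"
    using N(1) by (auto intro!: image_eqI[of _ _ "_ mod N"])
  then show ?thesis by (rule finite_subset) simp
qed

theorem theorem5p1:
  fixes a :: "'x::{topological_group_add, metric_space}"
    and A :: "real \<Rightarrow> real^'d \<Rightarrow> real^'d"
    and f :: "'x \<Rightarrow> (real^'d) \<times> real"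
  assumes "compact (UNIV :: 'x set)"
    and "locally_connected_space (euclidean :: 'x topology)"
    and "minimal_rotation a"
    and "\<And>u. linear (A u)"
    and "\<And>u. bij (A u)"
    and "A 0 = id"
    and "\<And>u w. A (u + w) = A u \<circ> A w"
    and "continuous_on UNIV (\<lambda>(u, v). A u v)"
    and "\<And>u v. u \<noteq> 0 \<Longrightarrow> A u v = v \<Longrightarrow> v = 0"
    and "continuous_on UNIV f"
    and "recurrent_cocycle A a f"
  shows "regular_cocycle A a f"
proof (cases "\<forall>n. n \<noteq> 0 \<longrightarrow> rot_pow a n 0 \<noteq> 0")
  case True
  interpret expansive_flow A
    by (intro expansive_flow.intro linear_flow.intro expansive_flow_axioms.intro)
      (use assms(4,6-9) in simp_all)
  interpret minimal_rot a
    by unfold_locales (use assms(1-3) True in auto)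
  interpret topological_group_on "sd_mult A" "sd_inv A"
    by (rule sd_group)
  interpret expansive_cocycle A a "cocycle A a f"
  proof unfold_locales
    show "\<exists>n y. n \<noteq> 0 \<and> y \<in> U \<and> T n y \<in> U \<and> cocycle A a f n y \<in> V"
      if "open V" "0 \<in> V" "open U" "U \<noteq> {}" for V and U :: "'x set"
    proof -
      have "\<exists>n. n \<noteq> 0 \<and> U \<inter> {x. T n x \<in> U} \<inter> {x. cocycle A a f n x \<in> V} \<noteq> {}"
        using assms(11) that unfolding recurrent_cocycle_def sd_unit_def zero_prod_def by simp
      then show ?thesis by auto
    qed
  qed (rule cocycle_add continuous_on_cocycle[OF assms(10)])+
  obtain x where x: "fst ` orb x = UNIV" using ex_orb_surj by blast
  have "{skew_pow A a f n (x, 0) |n. True} = range (\<lambda>n. (T n x, cocycle A a f n x))"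
    by (auto simp: skew_pow_def)
  then show ?thesis
    unfolding regular_cocycle_def using x by (intro exI[of _ "(x, 0)"]) (simp add: orb_def)
next
  case False
  \<comment> \<open>A finite dense orbit is the whole space, so the projection of any skew product
    orbit over it is already onto.\<close>
  then have "finite (range (\<lambda>k. rot_pow a k 0))"
    using finite_orbit_if_periodic by blast
  then have "range (\<lambda>k. rot_pow a k 0) = UNIV"
    using assms(3) closure_closed[OF finite_imp_closed, of "range (\<lambda>k. rot_pow a k 0)"]
    by (simp add: minimal_rotation_def full_SetCompr_eq)
  moreover have "rot_pow a k 0 \<in> fst ` closure {skew_pow A a f n (0, 0) |n. True}" for k
    by (rule image_eqI[of _ _ "skew_pow A a f k (0, 0)"])
      (auto simp: skew_pow_def intro!: subsetD[OF closure_subset])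
  then have "range (\<lambda>k. rot_pow a k 0) \<subseteq> fst ` closure {skew_pow A a f n (0, 0) |n. True}"
    by (intro image_subsetI)
  ultimately have "fst ` closure {skew_pow A a f n (0, 0) |n. True} = UNIV"
    by (simp only: top.extremum_unique)
  then show ?thesis unfolding regular_cocycle_def by blast
qed

end
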